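(* Let $n\geq5$, let $\mathcal{B}^n_f$ be a unit geodesic ball with warping function $f$, let $0<a<\pi/2$, and let $\varphi_a:\mathcal{B}^n_f\to\mathbb{S}^n$ be the map $(w,\rho)\mapsto(w,a)$. If $\varphi_a$ is weakly biharmonic, then $n=5$ or $n=6$, $\mathcal{B}^n_f$ is the Euclidean unit ball $B^n$ (i.e. $f(\rho)=\rho$), and $\varphi_a$ is one of the two maps given by: $n=5$ and $a=\pi/3$; or $n=6$ and $a=\frac12\arccos(-4/5)$.
   Context: Let $g_{\mathbb{S}}$ be the standard metric on $\mathbb{S}^{n-1}$. $\mathcal{B}^n_f$ denotes the unit geodesic ball, centred at the pole, given by the warped product $\left(\mathbb{S}^{n-1}\times I,\ f^2(\rho)g_{\mathbb{S}}+d\rho^2\right)$ with $\overline{I}=[0,1]$, where $f$ is smooth, positive on $I$, and satisfies the smoothness conditions at the pole $f(0)=0$, $f'(0)=1$, $f^{(2k)}(0)=0$ for all $k\ge1$ (the locus $\rho=0$ is collapsed to the pole). The case $f(\rho)=\rho$ is the Euclidean unit ball. The target sphere is written as $\mathbb{S}^n=\left(\mathbb{S}^{n-1}\times[0,\pi],\ \sin^2\!\alpha\,g_{\mathbb{S}}+d\alpha^2\right)$, so that $\varphi_a$ sends $(w,\rho)$ to $(w,a)$; it is smooth away from the pole. For a smooth map $\varphi:(M,g_M)\to(N,g_N)$ the tension field is $\tau(\varphi)=\mathrm{trace}_{g_M}\nabla d\varphi$, and $\varphi$ is biharmonic if it is a critical point of $E_2(\varphi)=\frac12\int_M|\tau(\varphi)|^2\,dV$.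 With $\mathbb{S}^n\subset\mathbb{R}^{n+1}$, $W^{2,2}(M,\mathbb{S}^n)$ is the set of $\varphi\in W^{2,2}(M,\mathbb{R}^{n+1})$ with values in $\mathbb{S}^n$ a.e.; a map in $W^{2,2}(M,\mathbb{S}^n)$ is weakly biharmonic if it solves the Euler-Lagrange equation of $E_2$ in the sense of distributions. For the maps $\varphi_a$ this is used in the equivalent form: $\varphi_a\in W^{2,2}(\mathcal{B}^n_f,\mathbb{S}^n)$ and $\varphi_a$ is biharmonic away from the pole. *)

theory Defs
  imports "HOL-Analysis.Analysis"
begin

primrec Ck_on :: "nat \<Rightarrow> 'a::real_normed_vector set \<Rightarrow> ('a \<Rightarrow> 'b::real_normed_vector) \<Rightarrow> bool" where
  "Ck_on 0 S f \<longleftrightarrow> continuous_on S f"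
| "Ck_on (Suc k) S f \<longleftrightarrow>
     (\<forall>x\<in>S. f differentiable (at x)) \<and> (\<forall>v. Ck_on k S (\<lambda>x. frechet_derivative f (at x) v))"

definition smooth_on :: "'a::real_normed_vector set \<Rightarrow> ('a \<Rightarrow> 'b::real_normed_vector) \<Rightarrow> bool" where
  "smooth_on S f \<longleftrightarrow> (\<forall>k. Ck_on k S f)"

definition pd :: "'n \<Rightarrow> (real^'n \<Rightarrow> 'b::real_normed_vector) \<Rightarrow> real^'n::finite \<Rightarrow> 'b" where
  "pd i F x = frechet_derivative F (at x) (axis i 1)"

text \<open>
  A metric \<open>g\<close> is given in one global chart: \<open>g x u v\<close> is the inner product of the tangent
  vectors \<open>u\<close>, \<open>v\<close> at \<open>x\<close>.
\<close>

type_synonym 'n metric = "real^'n \<Rightarrow> real^'n \<Rightarrow> real^'n \<Rightarrow> real"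

definition gram :: "'n::finite metric \<Rightarrow> real^'n \<Rightarrow> real^'n^'n" where
  "gram g x = (\<chi> i j. g x (axis i 1) (axis j 1))"

abbreviation ginv :: "'n::finite metric \<Rightarrow> real^'n \<Rightarrow> real^'n^'n" where
  "ginv g x \<equiv> matrix_inv (gram g x)"

definition vol_density :: "'n::finite metric \<Rightarrow> real^'n \<Rightarrow> real" where
  "vol_density g x = sqrt (det (gram g x))"

text \<open>The symbol \<open>\<Gamma>\<close> with upper index \<open>k\<close> and lower indices \<open>i\<close>, \<open>j\<close>.\<close>

definition christoffel :: "'n::finite metric \<Rightarrow> 'n \<Rightarrow> 'n \<Rightarrow> 'n \<Rightarrow> real^'n \<Rightarrow> real" where
  "christoffel g k i j x =
     (1/2) * (\<Sum>l\<in>UNIV. ginv g x $ k $ l *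
        (pd i (\<lambda>y. gram g y $ j $ l) x + pd j (\<lambda>y. gram g y $ i $ l) x
         - pd l (\<lambda>y. gram g y $ i $ j) x))"

text \<open>
  The covariant Hessian of a vector-valued function with first partial derivatives \<open>D i\<close> and
  second partial derivatives \<open>D2 i j\<close>.  The derivatives are arguments so that the formula serves
  both classical and weak derivatives.
\<close>

definition cov_hessian ::
  "'n::finite metric \<Rightarrow> ('n \<Rightarrow> real^'n \<Rightarrow> 'b) \<Rightarrow> ('n \<Rightarrow> 'n \<Rightarrow> real^'n \<Rightarrow> 'b)
    \<Rightarrow> 'n \<Rightarrow> 'n \<Rightarrow> real^'n \<Rightarrow> 'b::real_vector" where
  "cov_hessian g D D2 i j x = D2 i j x - (\<Sum>k\<in>UNIV. christoffel g k i j x *\<^sub>R D k x)"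

text \<open>
  The target is the unit sphere \<open>sphere 0 1\<close> of a Euclidean space with the induced metric.  Its
  Levi-Civita connection is the tangential part of the flat one, so \<open>\<nabla>d\<phi>\<close> is the tangential part
  of the covariant Hessian of \<open>\<phi>\<close> as a vector-valued function.
\<close>

definition tangent_proj :: "'b::real_inner \<Rightarrow> 'b \<Rightarrow> 'b" where
  "tangent_proj y v = v - (v \<bullet> y) *\<^sub>R y"

definition second_fund_form ::
  "'n::finite metric \<Rightarrow> (real^'n \<Rightarrow> 'b::real_inner) \<Rightarrow> 'n \<Rightarrow> 'n \<Rightarrow> real^'n \<Rightarrow> 'b" where
  "second_fund_form g \<phi> i j x =
     tangent_proj (\<phi> x) (cov_hessian g (\<lambda>k. pd k \<phi>) (\<lambda>k l. pd k (pd l \<phi>)) i j x)"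

definition tension :: "'n::finite metric \<Rightarrow> (real^'n \<Rightarrow> 'b::real_inner) \<Rightarrow> real^'n \<Rightarrow> 'b" where
  "tension g \<phi> x = (\<Sum>i\<in>UNIV. \<Sum>j\<in>UNIV. ginv g x $ i $ j *\<^sub>R second_fund_form g \<phi> i j x)"

definition bienergy :: "'n::finite metric \<Rightarrow> (real^'n) set \<Rightarrow> (real^'n \<Rightarrow> 'b::real_inner) \<Rightarrow> real" where
  "bienergy g K \<phi> = (1/2) * (LINT x:K|lborel. (norm (tension g \<phi> x))\<^sup>2 * vol_density g x)"

text \<open>
  Critical points of the bienergy with respect to compactly supported smooth variations through
  maps into the sphere.  As usual the energy is taken over a compact set containing the support
  of the variation, since the energy over all of \<open>U\<close> need not be finite.
\<close>

definition biharmonic_on ::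
  "'n::finite metric \<Rightarrow> (real^'n) set \<Rightarrow> (real^'n \<Rightarrow> 'b::real_inner) \<Rightarrow> bool" where
  "biharmonic_on g U \<phi> \<longleftrightarrow>
     smooth_on U \<phi> \<and> (\<forall>x\<in>U. \<phi> x \<in> sphere 0 1) \<and>
     (\<forall>\<epsilon> K \<Phi>.
        \<epsilon> > 0 \<and> compact K \<and> K \<subseteq> U \<and>
        smooth_on ({-\<epsilon><..<\<epsilon>} \<times> U) (\<lambda>(t, x). \<Phi> t x) \<and>
        (\<forall>t\<in>{-\<epsilon><..<\<epsilon>}. \<forall>x\<in>U. \<Phi> t x \<in> sphere 0 1) \<and>
        (\<forall>x\<in>U. \<Phi> 0 x = \<phi> x) \<and>
        (\<forall>t\<in>{-\<epsilon><..<\<epsilon>}. \<forall>x\<in>U - K. \<Phi> t x = \<phi> x)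
        \<longrightarrow> ((\<lambda>t. bienergy g K (\<Phi> t)) has_real_derivative 0) (at 0))"

definition locally_integrable_on ::
  "(real^'n::finite) set \<Rightarrow> (real^'n \<Rightarrow> 'b::euclidean_space) \<Rightarrow> bool" where
  "locally_integrable_on U u \<longleftrightarrow> (\<forall>K. compact K \<and> K \<subseteq> U \<longrightarrow> set_integrable lebesgue K u)"

definition test_function_on :: "(real^'n::finite) set \<Rightarrow> (real^'n \<Rightarrow> real) \<Rightarrow> bool" where
  "test_function_on U \<psi> \<longleftrightarrow>
     smooth_on UNIV \<psi> \<and> compact (closure {x. \<psi> x \<noteq> 0}) \<and> closure {x. \<psi> x \<noteq> 0} \<subseteq> U"

definition has_weak_pd ::
  "(real^'n::finite) set \<Rightarrow> 'n \<Rightarrow> (real^'n \<Rightarrow> 'b::euclidean_space) \<Rightarrow> (real^'n \<Rightarrow> 'b) \<Rightarrow> bool" where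
  "has_weak_pd U i u v \<longleftrightarrow>
     locally_integrable_on U u \<and> locally_integrable_on U v \<and>
     (\<forall>\<psi>. test_function_on U \<psi> \<longrightarrow>
        (LINT x:U|lebesgue. pd i \<psi> x *\<^sub>R u x) = - (LINT x:U|lebesgue. \<psi> x *\<^sub>R v x))"

text \<open>
  \<open>u\<close>, its weak differential and its weak covariant Hessian are square integrable over \<open>U\<close>, with
  pointwise norms and volume taken with respect to \<open>g\<close>.
\<close>

definition W22_on ::
  "'n::finite metric \<Rightarrow> (real^'n) set \<Rightarrow> (real^'n \<Rightarrow> 'b::euclidean_space) \<Rightarrow> bool" where
  "W22_on g U u \<longleftrightarrow>
     (\<exists>D D2.
        (\<forall>i. has_weak_pd U i u (D i)) \<and>
        (\<forall>i j. has_weak_pd U i (D j) (D2 i j)) \<and>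
        set_integrable lebesgue U (\<lambda>x. (norm (u x))\<^sup>2 * vol_density g x) \<and>
        set_integrable lebesgue U
          (\<lambda>x. (\<Sum>i\<in>UNIV. \<Sum>j\<in>UNIV. ginv g x $ i $ j * (D i x \<bullet> D j x)) * vol_density g x) \<and>
        set_integrable lebesgue U
          (\<lambda>x. (\<Sum>i\<in>UNIV. \<Sum>j\<in>UNIV. \<Sum>k\<in>UNIV. \<Sum>l\<in>UNIV.
                  ginv g x $ i $ k * ginv g x $ j $ l *
                  (cov_hessian g D D2 i j x \<bullet> cov_hessian g D D2 k l x)) * vol_density g x))"

definition W22_sphere_on ::
  "'n::finite metric \<Rightarrow> (real^'n) set \<Rightarrow> (real^'n \<Rightarrow> 'b::euclidean_space) \<Rightarrow> bool" where
  "W22_sphere_on g U u \<longleftrightarrow>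
     W22_on g U u \<and> (AE x in lebesgue. x \<in> U \<longrightarrow> u x \<in> sphere 0 1)"

primrec deriv01 :: "(real \<Rightarrow> real) \<Rightarrow> nat \<Rightarrow> real \<Rightarrow> real" where
  "deriv01 f 0 = f"
| "deriv01 f (Suc k) = (\<lambda>\<rho>. vector_derivative (deriv01 f k) (at \<rho> within {0..1}))"

definition warping_function :: "(real \<Rightarrow> real) \<Rightarrow> bool" where
  "warping_function f \<longleftrightarrow>
     (\<forall>k. \<forall>\<rho>\<in>{0..1}. deriv01 f k differentiable (at \<rho> within {0..1})) \<and>
     (\<forall>\<rho>\<in>{0<..<1}. f \<rho> > 0) \<and>
     f 0 = 0 \<and> deriv01 f 1 0 = 1 \<and> (\<forall>k\<ge>1. deriv01 f (2 * k) 0 = 0)"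

text \<open>
  The ball is \<open>ball 0 1\<close>, where \<open>x\<close> stands for the point \<open>(w, \<rho>) = (x / |x|, |x|)\<close> and \<open>0\<close> for the
  pole.  The metric is the pullback of \<open>f\<^sup>2(\<rho>) g_S + d\<rho>\<^sup>2\<close> under these polar coordinates, with
  \<open>g_S\<close> induced by the inner product of the ambient space; at the pole it is extended by
  continuity (as \<open>f(0) = 0\<close> and \<open>f'(0) = 1\<close>).
\<close>

definition warped_metric :: "(real \<Rightarrow> real) \<Rightarrow> ('n::finite) metric" where
  "warped_metric f x u v =
     (if x = 0 then u \<bullet> v
      else
        let dw = frechet_derivative (\<lambda>y::real^'n. y /\<^sub>R norm y) (at x);
            d\<rho> = frechet_derivative (\<lambda>y::real^'n. norm y) (at x)
        in (f (norm x))\<^sup>2 * (dw u \<bullet> dw v) + d\<rho> u * d\<rho> v)"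

text \<open>
  A point \<open>(w, \<alpha>)\<close> of the target sphere is \<open>(sin \<alpha> w, cos \<alpha>)\<close>.
\<close>

definition sphere_point :: "real^'n::finite \<Rightarrow> real \<Rightarrow> (real^'n) \<times> real" where
  "sphere_point w \<alpha> = (sin \<alpha> *\<^sub>R w, cos \<alpha>)"

text \<open>The value at the pole is irrelevant.\<close>

definition phi_map :: "real \<Rightarrow> real^'n::finite \<Rightarrow> (real^'n) \<times> real" where
  "phi_map a x = sphere_point (x /\<^sub>R norm x) a"

text \<open>
  For maps smooth away from the pole only.  The Euler-Lagrange equation is required on the
  punctured ball: for such \<open>W22\<close> maps this is the form in which weak biharmonicity is used, and
  any distributional solution on the whole ball satisfies it.
\<close>

definition weakly_biharmonic_ball ::
  "(real \<Rightarrow> real) \<Rightarrow> (real^'n::finite \<Rightarrow> 'b::euclidean_space) \<Rightarrow> bool" where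
  "weakly_biharmonic_ball f \<phi> \<longleftrightarrow>
     W22_sphere_on (warped_metric f) (ball 0 1) \<phi> \<and>
     biharmonic_on (warped_metric f) (ball 0 1 - {0}) \<phi>"

end

theory Submission
  imports Defs
begin

text \<open>
  Write \<open>m = n - 1\<close>, \<open>\<rho> = |x|\<close>, \<open>s = \<rho>\<^sup>2\<close>.  For a rotationally symmetric map, sending \<open>x\<close> to the point of
  the sphere over \<open>x / |x|\<close> at the angle \<open>\<alpha>\<close>, the tension field has only a component along the
  meridians, namely
  \<open>\<alpha>'' + m (f' / f) \<alpha>' - m sin \<alpha> cos \<alpha> / f\<^sup>2\<close>
  with derivatives in \<open>\<rho>\<close> (\<open>norm_tension_sphere_point\<close>).  The volume density is \<open>(f / \<rho>)\<^sup>m\<close>, so the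
  bienergy over a shell is, up to a constant, the integral over \<open>\<rho>\<close> of the square of this expression
  times \<open>f\<^sup>m\<close> (\<open>bienergy_radial\<close>).

  Take the variation \<open>\<alpha> = a + t \<eta>(\<rho>)\<close> with a smooth bump \<open>\<eta>\<close> supported in a shell inside the punctured
  ball.  At \<open>t = 0\<close> the tension is \<open>- m sin a cos a / f\<^sup>2\<close>, and \<open>sin a cos a\<close> is not zero because
  \<open>0 < a < \<pi>/2\<close>.  Hence the vanishing of the derivative of the bienergy says
  \<open>\<integral> f\<^sup>m\<^sup>-\<^sup>2 (\<eta>'' + m (f' / f) \<eta>' - m cos(2a) \<eta> / f\<^sup>2) d\<rho> = 0\<close>
  (\<open>radial_first_variation\<close>).  Integrating by parts and letting \<open>\<eta>\<close> concentrate at a point gives the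
  ordinary differential equation
  \<open>2 (m - 3) f'\<^sup>2 + 2 f f'' + m cos(2a) = 0\<close> on \<open>(0, 1)\<close>.

  At the pole \<open>f = 0\<close> and \<open>f' = 1\<close>, so by continuity \<open>m cos(2a) = - 2 (m - 3)\<close>.  Since
  \<open>cos(2a) > - 1\<close>, this forces \<open>m < 6\<close>; as \<open>n \<ge> 5\<close>, the remaining values \<open>m = 4\<close> and \<open>m = 5\<close> each determine \<open>a\<close>
  (\<open>critical_angle\<close>).  The equation becomes \<open>f f'' = - (m - 3) (f'\<^sup>2 - 1)\<close>, so that
  \<open>f\<^sup>2\<^sup>(\<^sup>m\<^sup>-\<^sup>3\<^sup>) (f'\<^sup>2 - 1)\<close> has derivative zero.  It vanishes at the pole, hence everywhere;
  then \<open>f'\<^sup>2 = 1\<close>, therefore \<open>f'' = 0\<close> and \<open>f(\<rho>) = \<rho>\<close> (\<open>warping_rigidity\<close>).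

  The variation must be smooth as a map of \<open>(t, x)\<close>, which is why the bump is taken as a function
  \<open>\<beta>\<close> of \<open>s = x \<bullet> x\<close>, with \<open>\<eta>(\<rho>) = \<beta>(\<rho>\<^sup>2)\<close>.  Below, the angle \<open>\<alpha>\<close> and the bump \<open>\<beta>\<close> are functions of \<open>s\<close>, and
  their derivatives are taken in \<open>s\<close>, while those of \<open>f\<close> are taken in \<open>\<rho>\<close>.
\<close>

section \<open>Maps with derivatives of all orders and a smooth bump\<close>

lemma Ck_on_cong:
  assumes "open S" "Ck_on k S f" "\<And>x. x \<in> S \<Longrightarrow> g x = f x"
  shows "Ck_on k S g"
  using assms(2,3)
proof (induction k arbitrary: f g)
  case 0
  then show ?case by (simp cong: continuous_on_cong)
next
  case (Suc k)
  have D: "(g has_derivative frechet_derivative f (at x)) (at x)" if "x \<in> S" for x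
  proof (rule has_derivative_transform_within_open)
    show "(f has_derivative frechet_derivative f (at x)) (at x)"
      using Suc.prems(1) that by (simp add: frechet_derivative_works[symmetric])
  qed (use that \<open>open S\<close> Suc.prems(2) in auto)
  have "Ck_on k S (\<lambda>x. frechet_derivative g (at x) v)" for v
  proof (rule Suc.IH)
    show "Ck_on k S (\<lambda>x. frechet_derivative f (at x) v)"
      using Suc.prems(1) by simp
    show "frechet_derivative g (at x) v = frechet_derivative f (at x) v" if "x \<in> S" for x
      using frechet_derivative_at[OF D[OF that]] by simp
  qed
  then show ?case
    using D by (auto intro: differentiableI)
qed

text \<open>
  The definition refers to the Frechet derivative at a point.  Any family \<open>D\<close> of derivatives may be
  used in its place because it agrees with the Frechet derivative on the open set \<open>S\<close>.
\<close>

lemma Ck_on_SucI: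
  assumes "open S" "\<And>x. x \<in> S \<Longrightarrow> (f has_derivative D x) (at x)"
    and "\<And>v. Ck_on k S (\<lambda>x. D x v)"
  shows "Ck_on (Suc k) S f"
proof -
  have "Ck_on k S (\<lambda>x. frechet_derivative f (at x) v)" for v
  proof (rule Ck_on_cong[OF assms(1) assms(3)])
    show "frechet_derivative f (at x) v = D x v" if "x \<in> S" for x
      using frechet_derivative_at[OF assms(2)[OF that]] by simp
  qed
  then show ?thesis
    using assms(2) by (auto intro: differentiableI)
qed

lemma Ck_on_derivative:
  assumes "Ck_on (Suc k) S f" "x \<in> S"
  shows "(f has_derivative frechet_derivative f (at x)) (at x)"
  using assms by (simp add: frechet_derivative_works[symmetric])

lemma Ck_on_SucD: "Ck_on (Suc k) S f \<Longrightarrow> Ck_on k S f"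
proof (induction k arbitrary: f)
  case 0
  then show ?case
    by (auto intro!: continuous_at_imp_continuous_on differentiable_imp_continuous_within)
next
  case (Suc k)
  have "Ck_on k S (\<lambda>x. frechet_derivative f (at x) v)" for v
    using Suc.prems by (intro Suc.IH) (subst (asm) Ck_on.simps(2), simp)
  then show ?case using Suc.prems by simp
qed

lemma Ck_on_const: "open S \<Longrightarrow> Ck_on k S (\<lambda>x. c)"
proof (induction k arbitrary: c)
  case (Suc k)
  show ?case
    by (rule Ck_on_SucI[where D = "\<lambda>_ _. 0"]) (use Suc in auto)
qed simp

lemma Ck_on_bounded_linear:
  assumes "open S" "bounded_linear L"
  shows "Ck_on k S L"
proof (cases k)
  case 0
  then show ?thesis
    using assms by (simp add: linear_continuous_on)
next
  case (Suc k')
  show ?thesis unfolding Suc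
    by (rule Ck_on_SucI[where D = "\<lambda>_. L"])
      (use assms in \<open>auto intro: Ck_on_const bounded_linear_imp_has_derivative\<close>)
qed

lemma Ck_on_add:
  assumes "open S" "Ck_on k S f" "Ck_on k S g"
  shows "Ck_on k S (\<lambda>x. f x + g x)"
  using assms(2,3)
proof (induction k arbitrary: f g)
  case 0
  then show ?case by (simp add: continuous_on_add)
next
  case (Suc k)
  show ?case
    by (rule Ck_on_SucI[OF \<open>open S\<close> has_derivative_add[OF Ck_on_derivative Ck_on_derivative]])
      (use Suc in auto)
qed

text \<open>
  One product rule covers real multiplication, scaling of vectors and inner products.
\<close>

lemma Ck_on_bilinear:
  assumes "open S" "bounded_bilinear bil" "Ck_on k S f" "Ck_on k S g"
  shows "Ck_on k S (\<lambda>x. bil (f x) (g x))"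
  using assms(3,4)
proof (induction k arbitrary: f g)
  case 0
  then show ?case
    using bounded_bilinear.continuous_on[OF assms(2)] by simp
next
  case (Suc k)
  have "Ck_on k S (\<lambda>x. bil (f x) (frechet_derivative g (at x) v)
      + bil (frechet_derivative f (at x) v) (g x))" for v
    using Suc.prems Ck_on_SucD[OF Suc.prems(1)] Ck_on_SucD[OF Suc.prems(2)]
    by (intro Ck_on_add Suc.IH \<open>open S\<close>) auto
  then show ?case
    by (rule Ck_on_SucI[OF \<open>open S\<close>
          bounded_bilinear.FDERIV[OF assms(2) Ck_on_derivative Ck_on_derivative], rotated 4])
      (use Suc in auto)
qed

lemma Ck_on_Pair:
  assumes "open S" "Ck_on k S f" "Ck_on k S g"
  shows "Ck_on k S (\<lambda>x. (f x, g x))"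
  using assms(2,3)
proof (induction k arbitrary: f g)
  case 0
  then show ?case by (simp add: continuous_on_Pair)
next
  case (Suc k)
  show ?case
    by (rule Ck_on_SucI[OF \<open>open S\<close> has_derivative_Pair[OF Ck_on_derivative Ck_on_derivative]])
      (use Suc in auto)
qed

text \<open>
  The induction is over functions \<open>g\<close> for a fixed inner function \<open>h\<close>: the derivative of the
  composition is \<open>g'(h x)\<close>, again such a composition, times a directional derivative of \<open>h\<close>.
\<close>

lemma Ck_on_compose_real:
  fixes h :: "'a::real_normed_vector \<Rightarrow> real"
  assumes "open S" "Ck_on k I g" "Ck_on k S h" "h ` S \<subseteq> I"
  shows "Ck_on k S (\<lambda>x. g (h x))"
  using assms(2,3)
proof (induction k arbitrary: g)
  case 0
  then show ?case
    using assms(4) continuous_on_compose2 by auto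
next
  case (Suc k)
  have "Ck_on k S (\<lambda>x. frechet_derivative h (at x) v *\<^sub>R frechet_derivative g (at (h x)) 1)" for v
    using Suc.prems Ck_on_SucD[OF Suc.prems(2)]
    by (intro Ck_on_bilinear[OF \<open>open S\<close> bounded_bilinear_scaleR]
        Suc.IH[where g = "\<lambda>y. frechet_derivative g (at y) 1"]) auto
  moreover have "((\<lambda>x. g (h x)) has_derivative
      (\<lambda>v. frechet_derivative h (at x) v *\<^sub>R frechet_derivative g (at (h x)) 1)) (at x)"
    if "x \<in> S" for x
  proof -
    have "h x \<in> I" using that assms(4) by auto
    then have g: "(g has_derivative frechet_derivative g (at (h x))) (at (h x))"
      using Suc.prems(1) Ck_on_derivative by blast
    have "frechet_derivative g (at (h x)) (frechet_derivative h (at x) v)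
        = frechet_derivative h (at x) v *\<^sub>R frechet_derivative g (at (h x)) 1" for v
      using linear_scale[OF has_derivative_linear[OF g], of "frechet_derivative h (at x) v" 1] by simp
    then show ?thesis
      using has_derivative_compose[OF Ck_on_derivative[OF Suc.prems(2) that] g] by simp
  qed
  ultimately show ?case
    by (intro Ck_on_SucI[OF \<open>open S\<close>]) auto
qed

lemma smooth_on_const: "open S \<Longrightarrow> smooth_on S (\<lambda>x. c)"
  by (simp add: smooth_on_def Ck_on_const)

lemma smooth_on_bounded_linear: "open S \<Longrightarrow> bounded_linear L \<Longrightarrow> smooth_on S L"
  by (simp add: smooth_on_def Ck_on_bounded_linear)

lemma smooth_on_add:
  "open S \<Longrightarrow> smooth_on S f \<Longrightarrow> smooth_on S g \<Longrightarrow> smooth_on S (\<lambda>x. f x + g x)"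
  by (simp add: smooth_on_def Ck_on_add)

lemma smooth_on_bilinear:
  "open S \<Longrightarrow> bounded_bilinear bil \<Longrightarrow> smooth_on S f \<Longrightarrow> smooth_on S g
    \<Longrightarrow> smooth_on S (\<lambda>x. bil (f x) (g x))"
  by (simp add: smooth_on_def Ck_on_bilinear)

lemma smooth_on_Pair:
  "open S \<Longrightarrow> smooth_on S f \<Longrightarrow> smooth_on S g \<Longrightarrow> smooth_on S (\<lambda>x. (f x, g x))"
  by (simp add: smooth_on_def Ck_on_Pair)

lemma smooth_on_compose_real:
  fixes h :: "'a::real_normed_vector \<Rightarrow> real"
  shows "open S \<Longrightarrow> smooth_on I g \<Longrightarrow> smooth_on S h \<Longrightarrow> h ` S \<subseteq> I \<Longrightarrow> smooth_on S (\<lambda>x. g (h x))"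
  unfolding smooth_on_def using Ck_on_compose_real by blast

lemma smooth_on_cong:
  "open S \<Longrightarrow> smooth_on S f \<Longrightarrow> (\<And>x. x \<in> S \<Longrightarrow> g x = f x) \<Longrightarrow> smooth_on S g"
  unfolding smooth_on_def using Ck_on_cong by blast

text \<open>
  Smoothness on the line follows from an explicit formula for all iterated derivatives; this is how
  sine, real powers and the flat exponential are treated.
\<close>

lemma smooth_on_derivative_sequence:
  fixes G :: "nat \<Rightarrow> real \<Rightarrow> real"
  assumes "open I" "\<And>k y. y \<in> I \<Longrightarrow> (G k has_real_derivative G (Suc k) y) (at y)"
  shows "smooth_on I (G 0)"
proof -
  have "Ck_on k I (G j)" for k j
  proof (induction k arbitrary: j)
    case 0
    then show ?case
      using assms(2) by (auto intro!: continuous_at_imp_continuous_on DERIV_isCont)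
  next
    case (Suc k)
    show ?case
    proof (rule Ck_on_SucI[OF assms(1)])
      show "(G j has_derivative (\<lambda>v. v *\<^sub>R G (Suc j) y)) (at y)" if "y \<in> I" for y
        using assms(2)[OF that, of j] by (simp add: has_field_derivative_def mult.commute[of _ "G (Suc j) y"])
      show "Ck_on k I (\<lambda>x. v *\<^sub>R G (Suc j) x)" for v
        by (intro Ck_on_bilinear[OF assms(1) bounded_bilinear_scaleR] Ck_on_const assms(1) Suc.IH)
    qed
  qed
  then show ?thesis by (simp add: smooth_on_def)
qed

lemma smooth_on_real_derivative:
  fixes g :: "real \<Rightarrow> real"
  assumes "smooth_on I g"
  obtains g' where "\<And>y. y \<in> I \<Longrightarrow> (g has_real_derivative g' y) (at y)" "smooth_on I g'"
proof
  let ?g' = "\<lambda>y. frechet_derivative g (at y) 1"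
  show "smooth_on I ?g'"
    unfolding smooth_on_def
  proof
    show "Ck_on k I ?g'" for k
      using assms[unfolded smooth_on_def, rule_format, of "Suc k"] by simp
  qed
  show "(g has_real_derivative ?g' y) (at y)" if "y \<in> I" for y
  proof -
    have *: "(g has_derivative frechet_derivative g (at y)) (at y)"
      using assms that Ck_on_derivative unfolding smooth_on_def by blast
    have "frechet_derivative g (at y) v = ?g' y * v" for v
      using linear_scale[OF has_derivative_linear[OF *], of v 1] by simp
    then have "frechet_derivative g (at y) = (*) (?g' y)" by (rule ext)
    then show ?thesis
      unfolding has_field_derivative_def by (rule has_derivative_eq_rhs[OF *])
  qed
qed

lemma smooth_on_sin: "smooth_on UNIV (sin :: real \<Rightarrow> real)"
proof -
  define G :: "nat \<Rightarrow> real \<Rightarrow> real" where "G k y = sin (y + of_nat k * (pi/2))" for k y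
  have "smooth_on UNIV (G 0)"
  proof (rule smooth_on_derivative_sequence)
    show "(G k has_real_derivative G (Suc k) y) (at y)" for k y
    proof -
      have "G (Suc k) y = sin ((y + of_nat k * (pi/2)) + pi/2)"
        by (simp add: G_def algebra_simps add_divide_distrib)
      also have "\<dots> = cos (y + of_nat k * (pi/2))"
        by (subst sin_add) simp
      finally have "G (Suc k) y = cos (y + of_nat k * (pi/2))" .
      then show ?thesis unfolding G_def by (auto intro!: derivative_eq_intros)
    qed
  qed simp
  then show ?thesis by (simp add: G_def[abs_def])
qed

lemma smooth_on_cos: "smooth_on UNIV (cos :: real \<Rightarrow> real)"
proof -
  obtain g' where g': "\<And>y. y \<in> UNIV \<Longrightarrow> (sin has_real_derivative g' y) (at y)" "smooth_on UNIV g'"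
    by (rule smooth_on_real_derivative[OF smooth_on_sin]) (rule that)
  have "g' = cos"
    by (rule ext) (rule DERIV_unique[OF g'(1)[OF UNIV_I] DERIV_sin])
  then show ?thesis using g'(2) by simp
qed

lemma smooth_on_powr: "smooth_on {0<..} (\<lambda>y::real. y powr p)"
proof -
  define G :: "nat \<Rightarrow> real \<Rightarrow> real"
    where "G k y = (\<Prod>i<k. p - of_nat i) * y powr (p - of_nat k)" for k y
  have "smooth_on {0<..} (G 0)"
  proof (rule smooth_on_derivative_sequence)
    show "(G k has_real_derivative G (Suc k) y) (at y)" if "y \<in> {0<..}" for k y
    proof -
      have "(G k has_real_derivative
          (\<Prod>i<k. p - of_nat i) * ((p - of_nat k) * y powr (p - of_nat k - 1))) (at y)"
        unfolding G_def using that by (intro DERIV_cmult has_real_derivative_powr) auto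
      moreover have "p - of_nat k - 1 = p - of_nat (Suc k)" by simp
      ultimately show ?thesis
        by (simp only: G_def prod.lessThan_Suc mult.assoc)
    qed
  qed simp
  then show ?thesis by (simp add: G_def[abs_def])
qed

text \<open>
  The standard example of a smooth function that is not analytic: all its derivatives vanish at 0.
\<close>

definition flat_exp :: "real \<Rightarrow> real" where
  "flat_exp x = (if x \<le> 0 then 0 else exp (- (1 / x)))"

lemma poly_times_exp_neg_tendsto_0:
  fixes p :: "real poly"
  shows "((\<lambda>y. poly p y * exp (- y)) \<longlongrightarrow> 0) at_top"
proof -
  have "((\<lambda>y. \<Sum>i\<le>degree p. coeff p i * (y ^ i / exp y)) \<longlongrightarrow> (\<Sum>i\<le>degree p. coeff p i * 0)) at_top"
    by (intro tendsto_sum tendsto_mult tendsto_const tendsto_power_div_exp_0)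
  then show ?thesis
    by (simp add: poly_altdef exp_minus field_simps sum_distrib_right sum_distrib_left sum_divide_distrib)
qed

text \<open>
  For positive arguments the derivative of \<open>P(1/x) exp(-1/x)\<close> has the same form, with the polynomial
  \<open>y\<^sup>2 (P(y) - P'(y))\<close> in place of \<open>P(y)\<close>.  At 0 the exponential beats every polynomial in \<open>1/x\<close>.
\<close>

lemma smooth_on_flat_exp: "smooth_on UNIV flat_exp"
proof -
  define P :: "nat \<Rightarrow> real poly"
    where "P = rec_nat 1 (\<lambda>_ p. [:0, 0, 1:] * (p - pderiv p))"
  have P: "P 0 = 1" "P (Suc k) = [:0, 0, 1:] * (P k - pderiv (P k))" for k
    by (simp_all add: P_def)
  define G :: "nat \<Rightarrow> real \<Rightarrow> real"
    where "G k x = (if x \<le> 0 then 0 else poly (P k) (1 / x) * exp (- (1 / x)))" for k x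
  have "smooth_on UNIV (G 0)"
  proof (rule smooth_on_derivative_sequence)
    fix k and y :: real
    consider "y < 0" | "y = 0" | "y > 0" by linarith
    then show "(G k has_real_derivative G (Suc k) y) (at y)"
    proof cases
      case 1
      have "((\<lambda>_. 0) has_real_derivative 0) (at y)" by simp
      then have "(G k has_real_derivative 0) (at y)"
        by (rule has_field_derivative_transform_within_open[where S = "{..<0}"])
          (use 1 in \<open>auto simp: G_def\<close>)
      then show ?thesis using 1 by (simp add: G_def)
    next
      case 3
      have "((\<lambda>x. poly (P k) (1 / x) * exp (- (1 / x))) has_real_derivative G (Suc k) y) (at y)"
        using 3 by (auto intro!: derivative_eq_intros poly_DERIV DERIV_chain2[OF poly_DERIV]
            simp: G_def P field_simps power2_eq_square)
      then show ?thesis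
        by (rule has_field_derivative_transform_within_open[where S = "{0<..}"])
          (use 3 in \<open>auto simp: G_def\<close>)
    next
      case 2
      have "((\<lambda>h. (G k (0 + h) - G k 0) / h) \<longlongrightarrow> 0) (at (0::real))"
      proof (rule filterlim_split_at_real)
        have "((\<lambda>h::real. 0) \<longlongrightarrow> 0) (at_left (0::real))" by simp
        then show "((\<lambda>h. (G k (0 + h) - G k 0) / h) \<longlongrightarrow> 0) (at_left 0)"
          by (rule Lim_transform_eventually)
            (auto simp: eventually_at_filter G_def intro!: always_eventually)
        have "((\<lambda>h. poly ([:0, 1:] * P k) (inverse h) * exp (- inverse h)) \<longlongrightarrow> 0) (at_right 0)"
          by (rule filterlim_compose[OF poly_times_exp_neg_tendsto_0 filterlim_inverse_at_top_right])
        then show "((\<lambda>h. (G k (0 + h) - G k 0) / h) \<longlongrightarrow> 0) (at_right 0)"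
          by (rule Lim_transform_eventually)
            (auto simp: eventually_at_filter G_def field_simps intro!: always_eventually)
      qed
      then show ?thesis using 2 by (simp add: DERIV_def G_def)
    qed
  qed simp
  moreover have "G 0 = flat_exp" by (auto simp: G_def flat_exp_def P)
  ultimately show ?thesis by simp
qed

text \<open>
  The derivatives are part of the notion because the bienergy involves two of them; the values of
  \<open>\<beta>'\<close> at the end points enter the boundary terms of an integration by parts.
\<close>

definition is_bump :: "real \<Rightarrow> real \<Rightarrow> (real \<Rightarrow> real) \<Rightarrow> (real \<Rightarrow> real) \<Rightarrow> (real \<Rightarrow> real) \<Rightarrow> bool" where
  "is_bump p q \<beta> \<beta>' \<beta>'' \<longleftrightarrow> smooth_on UNIV \<beta> \<and>
    (\<forall>s. (\<beta> has_real_derivative \<beta>' s) (at s)) \<and> (\<forall>s. (\<beta>' has_real_derivative \<beta>'' s) (at s)) \<and>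
    continuous_on UNIV \<beta>'' \<and>
    (\<forall>s. s \<in> {p<..<q} \<longrightarrow> \<beta> s > 0) \<and> (\<forall>s. s \<notin> {p<..<q} \<longrightarrow> \<beta> s = 0) \<and>
    \<beta>' p = 0 \<and> \<beta>' q = 0"

lemma smooth_bump_exists:
  assumes "p < q"
  shows "\<exists>\<beta> \<beta>' \<beta>''. is_bump p q \<beta> \<beta>' \<beta>''"
proof -
  define \<beta> where "\<beta> s = flat_exp (s - p) * flat_exp (q - s)" for s
  have lin: "smooth_on UNIV (\<lambda>s::real. s - p)" "smooth_on UNIV (\<lambda>s. q - s)"
    using smooth_on_add[OF open_UNIV smooth_on_bounded_linear[OF open_UNIV bounded_linear_ident]
        smooth_on_const[OF open_UNIV, of "- p"]]
      smooth_on_add[OF open_UNIV smooth_on_bounded_linear[OF open_UNIV bounded_linear_minus[OF bounded_linear_ident]]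
        smooth_on_const[OF open_UNIV, of q]]
    by simp_all
  have "smooth_on UNIV (\<lambda>s. flat_exp (s - p) * flat_exp (q - s))"
    by (rule smooth_on_bilinear[OF open_UNIV bounded_bilinear_mult
          smooth_on_compose_real[OF open_UNIV smooth_on_flat_exp lin(1)]
          smooth_on_compose_real[OF open_UNIV smooth_on_flat_exp lin(2)]]) auto
  then have smooth: "smooth_on UNIV \<beta>" by (simp add: \<beta>_def[abs_def])
  obtain \<beta>' where 1: "\<And>s. s \<in> UNIV \<Longrightarrow> (\<beta> has_real_derivative \<beta>' s) (at s)" "smooth_on UNIV \<beta>'"
    by (rule smooth_on_real_derivative[OF smooth]) (rule that)
  obtain \<beta>'' where 2: "\<And>s. s \<in> UNIV \<Longrightarrow> (\<beta>' has_real_derivative \<beta>'' s) (at s)" "smooth_on UNIV \<beta>''"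
    by (rule smooth_on_real_derivative[OF 1(2)]) (rule that)
  have pos: "\<beta> s > 0" if "s \<in> {p<..<q}" for s
    using that by (simp add: \<beta>_def flat_exp_def)
  have zero: "\<beta> s = 0" if "s \<notin> {p<..<q}" for s
    using that by (auto simp: \<beta>_def flat_exp_def)
  have nonneg: "\<beta> s \<ge> 0" for s
    using pos[of s] zero[of s] by fastforce
  \<comment> \<open>Where the nonnegative function vanishes it has a minimum.\<close>
  have "\<beta>' s = 0" if "s \<notin> {p<..<q}" for s
    using zero[OF that] nonneg by (intro DERIV_local_min[OF 1(1)[OF UNIV_I], of 1 s]) auto
  then have "\<beta>' p = 0" "\<beta>' q = 0" by auto
  moreover have "continuous_on UNIV \<beta>''"
    using 2(2)[unfolded smooth_on_def, rule_format, of 0] by simp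
  ultimately have "is_bump p q \<beta> \<beta>' \<beta>''"
    unfolding is_bump_def using smooth 1(1)[OF UNIV_I] 2(1)[OF UNIV_I] pos zero by blast
  then show ?thesis by blast
qed

section \<open>Matrices of the form identity plus rank one, and the warped metric\<close>

lemma pd_eqI: "(F has_derivative F') (at x) \<Longrightarrow> pd i F x = F' (axis i 1)"
  by (simp add: pd_def frechet_derivative_at[symmetric])

lemma has_derivative_norm_nonzero:
  fixes x :: "'a::real_inner"
  assumes "x \<noteq> 0"
  shows "(norm has_derivative (\<lambda>u. (x \<bullet> u) / norm x)) (at x)"
  using has_derivative_norm[OF assms] by (simp add: sgn_div_norm inner_commute divide_inverse mult.commute)

lemma frechet_derivative_unit_vector:
  fixes x :: "'a::real_inner"
  assumes "x \<noteq> 0"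
  shows "frechet_derivative (\<lambda>y. y /\<^sub>R norm y) (at x) = (\<lambda>u. (u - ((x \<bullet> u) / (x \<bullet> x)) *\<^sub>R x) /\<^sub>R norm x)"
proof -
  have "((\<lambda>y. y /\<^sub>R norm y) has_derivative
      (\<lambda>u. (u - ((x \<bullet> u) / (x \<bullet> x)) *\<^sub>R x) /\<^sub>R norm x)) (at x)"
    using assms
    by (auto intro!: derivative_eq_intros has_derivative_norm_nonzero
        simp: dot_square_norm fun_eq_iff algebra_simps divide_simps power2_eq_square)
  then show ?thesis by (simp add: frechet_derivative_at[symmetric])
qed

text \<open>
  In the Cartesian chart the metric at \<open>x\<close> is the identity in the radial direction and
  \<open>f(\<rho>)\<^sup>2 / \<rho>\<^sup>2\<close> times the identity on the orthogonal complement of \<open>x\<close>.  The second number is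
  considered as a function of \<open>s = \<rho>\<^sup>2\<close>.
\<close>

definition tangential_factor :: "(real \<Rightarrow> real) \<Rightarrow> real \<Rightarrow> real" where
  "tangential_factor f s = (f (sqrt s))\<^sup>2 / s"

lemma warped_metric_eq:
  assumes "x \<noteq> 0"
  shows "warped_metric f x u v =
    tangential_factor f (x \<bullet> x) * (u \<bullet> v) + (1 - tangential_factor f (x \<bullet> x)) / (x \<bullet> x) * ((x \<bullet> u) * (x \<bullet> v))"
proof -
  have s: "x \<bullet> x \<noteq> 0" "norm x * norm x = x \<bullet> x" "sqrt (x \<bullet> x) = norm x"
    using assms by (simp_all add: dot_square_norm power2_eq_square[symmetric])
  have *: "(u - ((x \<bullet> u) / (x \<bullet> x)) *\<^sub>R x) \<bullet> (v - ((x \<bullet> v) / (x \<bullet> x)) *\<^sub>R x)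
      = u \<bullet> v - (x \<bullet> u) * (x \<bullet> v) / (x \<bullet> x)"
    using s(1) by (simp add: inner_diff_left inner_diff_right inner_commute field_simps)
  have N: "frechet_derivative norm (at x) = (\<lambda>u. (x \<bullet> u) / norm x)"
    using has_derivative_norm_nonzero[OF assms] by (simp add: frechet_derivative_at[symmetric])
  have "warped_metric f x u v = (f (norm x))\<^sup>2 * ((u - ((x \<bullet> u) / (x \<bullet> x)) *\<^sub>R x) \<bullet> (v - ((x \<bullet> v) / (x \<bullet> x)) *\<^sub>R x))
      / (norm x * norm x) + (x \<bullet> u) * (x \<bullet> v) / (norm x * norm x)"
    using assms unfolding warped_metric_def Let_def frechet_derivative_unit_vector[OF assms] N
    by (simp add: divide_inverse mult_ac)
  then show ?thesis
    unfolding * s(2) tangential_factor_def s(3) using s(1) by (simp add: field_simps)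
qed

text \<open>
  The Gram matrix of the warped metric has the form \<open>\<alpha> I + \<beta> x x\<^sup>T\<close>.  Such matrices are closed under
  products, which makes inverses explicit.
\<close>

definition id_plus_outer :: "real \<Rightarrow> real \<Rightarrow> real^'n::finite \<Rightarrow> real^'n^'n" where
  "id_plus_outer \<alpha> \<beta> x = (\<chi> i j. \<alpha> * (if i = j then 1 else 0) + \<beta> * (x $ i * x $ j))"

lemma sum_id_plus_outer_scaleR:
  fixes G :: "'n::finite \<Rightarrow> 'b::real_vector"
  shows "(\<Sum>l\<in>UNIV. id_plus_outer \<alpha> \<beta> x $ k $ l *\<^sub>R G l)
    = \<alpha> *\<^sub>R G k + (\<beta> * x $ k) *\<^sub>R (\<Sum>l\<in>UNIV. x $ l *\<^sub>R G l)"
proof -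
  have "id_plus_outer \<alpha> \<beta> x $ k $ l *\<^sub>R G l
      = (if k = l then \<alpha> *\<^sub>R G l else 0) + (\<beta> * x $ k) *\<^sub>R (x $ l *\<^sub>R G l)" for l
    by (simp add: id_plus_outer_def algebra_simps)
  then show ?thesis
    by (simp add: sum.distrib scaleR_sum_right)
qed

lemmas sum_id_plus_outer = sum_id_plus_outer_scaleR[where 'b = real, unfolded real_scaleR_def]

lemma inner_real_vec: "(x::real^'n::finite) \<bullet> y = (\<Sum>i\<in>UNIV. x $ i * y $ i)"
  by (simp add: inner_vec_def)

lemma id_plus_outer_mult:
  "id_plus_outer \<alpha> \<beta> x ** id_plus_outer \<gamma> \<delta> x
    = id_plus_outer (\<alpha> * \<gamma>) (\<alpha> * \<delta> + \<beta> * \<gamma> + \<beta> * \<delta> * (x \<bullet> x)) x"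
proof -
  have S: "(\<Sum>k\<in>UNIV. x $ k * id_plus_outer \<gamma> \<delta> x $ k $ j) = \<gamma> * x $ j + \<delta> * (x \<bullet> x) * x $ j" for j
  proof -
    have "x $ k * id_plus_outer \<gamma> \<delta> x $ k $ j
        = (if k = j then \<gamma> * x $ k else 0) + \<delta> * x $ j * (x $ k * x $ k)" for k
      by (simp add: id_plus_outer_def algebra_simps)
    then show ?thesis
      by (simp add: sum.distrib sum_distrib_left[symmetric] inner_real_vec)
  qed
  have "(id_plus_outer \<alpha> \<beta> x ** id_plus_outer \<gamma> \<delta> x) $ i $ j
      = \<alpha> * id_plus_outer \<gamma> \<delta> x $ i $ j + \<beta> * x $ i * (\<gamma> * x $ j + \<delta> * (x \<bullet> x) * x $ j)" for i j
    by (simp add: matrix_matrix_mult_def sum_id_plus_outer S)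
  then show ?thesis by (simp add: vec_eq_iff id_plus_outer_def algebra_simps)
qed

lemma mat_1_eq_id_plus_outer: "mat 1 = id_plus_outer 1 0 x"
  by (simp add: mat_def id_plus_outer_def vec_eq_iff)

text \<open>
  The formula of Sherman and Morrison.
\<close>

lemma matrix_inv_id_plus_outer:
  assumes "\<alpha> \<noteq> 0" "\<alpha> + \<beta> * (x \<bullet> x) \<noteq> 0"
  shows "matrix_inv (id_plus_outer \<alpha> \<beta> x)
    = id_plus_outer (1 / \<alpha>) (- \<beta> / (\<alpha> * (\<alpha> + \<beta> * (x \<bullet> x)))) x"
proof -
  let ?M = "id_plus_outer \<alpha> \<beta> x"
  let ?N = "id_plus_outer (1 / \<alpha>) (- \<beta> / (\<alpha> * (\<alpha> + \<beta> * (x \<bullet> x)))) x"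
  have "\<alpha> * (- \<beta> / (\<alpha> * (\<alpha> + \<beta> * (x \<bullet> x)))) + \<beta> * (1 / \<alpha>)
      + \<beta> * (- \<beta> / (\<alpha> * (\<alpha> + \<beta> * (x \<bullet> x)))) * (x \<bullet> x) = 0"
  proof -
    define r where "r = \<alpha> + \<beta> * (x \<bullet> x)"
    have "r \<noteq> 0" using assms by (simp add: r_def)
    have "\<alpha> * (- \<beta> / (\<alpha> * r)) + \<beta> * (1 / \<alpha>) + \<beta> * (- \<beta> / (\<alpha> * r)) * (x \<bullet> x)
      = \<beta> * (r - (\<alpha> + \<beta> * (x \<bullet> x))) / (\<alpha> * r)"
      using assms(1) \<open>r \<noteq> 0\<close> by (simp add: field_simps)
    then show ?thesis by (simp add: r_def)
  qed
  then have MN: "?M ** ?N = mat 1"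
    using assms(1) by (simp add: id_plus_outer_mult mat_1_eq_id_plus_outer[of x])
  then have NM: "?N ** ?M = mat 1"
    by (simp add: matrix_left_right_inverse)
  have "\<exists>A'. ?M ** A' = mat 1 \<and> A' ** ?M = mat 1"
    using MN NM by blast
  then have "?M ** matrix_inv ?M = mat 1 \<and> matrix_inv ?M ** ?M = mat 1"
    unfolding matrix_inv_def by (rule someI_ex)
  then have "matrix_inv ?M = (?N ** ?M) ** matrix_inv ?M"
    by (simp only: NM matrix_mul_lid)
  also have "\<dots> = ?N"
    using \<open>?M ** matrix_inv ?M = mat 1 \<and> _\<close>
    by (simp only: matrix_mul_assoc[symmetric] matrix_mul_rid)
  finally show ?thesis .
qed

lemma id_plus_outer_orthogonal:
  assumes "orthogonal_matrix Q"
  shows "id_plus_outer \<alpha> \<beta> (Q *v y) = Q ** id_plus_outer \<alpha> \<beta> y ** transpose Q"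
proof -
  have Q: "(\<Sum>k\<in>UNIV. Q $ i $ k * Q $ j $ k) = (if i = j then 1 else 0)" for i j
    using assms unfolding orthogonal_matrix_def
    by (auto simp: vec_eq_iff matrix_matrix_mult_def transpose_def mat_def)
  have "(Q ** id_plus_outer \<alpha> \<beta> y ** transpose Q) $ i $ j = id_plus_outer \<alpha> \<beta> (Q *v y) $ i $ j" for i j
  proof -
    have "(Q ** id_plus_outer \<alpha> \<beta> y ** transpose Q) $ i $ j
        = (\<Sum>k\<in>UNIV. Q $ i $ k * (id_plus_outer \<alpha> \<beta> y ** transpose Q) $ k $ j)"
      by (subst matrix_mul_assoc[symmetric]) (simp add: matrix_matrix_mult_def[of Q])
    also have "\<dots> = (\<Sum>k\<in>UNIV. Q $ i $ k * (\<alpha> * Q $ j $ k + \<beta> * y $ k * (\<Sum>l\<in>UNIV. y $ l * Q $ j $ l)))"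
      by (simp add: matrix_matrix_mult_def sum_id_plus_outer transpose_def)
    also have "\<dots> = \<alpha> * (\<Sum>k\<in>UNIV. Q $ i $ k * Q $ j $ k)
        + \<beta> * (\<Sum>k\<in>UNIV. Q $ i $ k * y $ k) * (\<Sum>l\<in>UNIV. Q $ j $ l * y $ l)"
      by (simp add: distrib_left sum.distrib sum_distrib_left sum_distrib_right mult_ac)
    finally show ?thesis
      by (simp add: Q id_plus_outer_def matrix_vector_mult_def)
  qed
  then show ?thesis by (simp add: vec_eq_iff)
qed

text \<open>
  An orthogonal matrix taking a coordinate axis to the direction of \<open>x\<close> makes the matrix diagonal,
  with one entry \<open>\<alpha> + \<beta> |x|\<^sup>2\<close> and the others equal to \<open>\<alpha>\<close>.
\<close>

lemma det_id_plus_outer: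
  fixes x :: "real^'n::finite"
  shows "det (id_plus_outer \<alpha> \<beta> x) = \<alpha> ^ (CARD('n) - 1) * (\<alpha> + \<beta> * (x \<bullet> x))"
proof -
  obtain k :: 'n where True by simp
  obtain Q :: "real^'n^'n" where Q: "orthogonal_matrix Q" and Qx: "x = Q *v (norm x *\<^sub>R axis k 1)"
  proof (cases "x = 0")
    case True
    then show ?thesis using that[of "mat 1"] by (simp add: orthogonal_matrix_id)
  next
    case False
    then have "norm (x /\<^sub>R norm x) = 1" by simp
    then obtain Q :: "real^'n^'n" where "orthogonal_matrix Q" "Q *v axis k 1 = x /\<^sub>R norm x"
      using orthogonal_matrix_exists_basis by metis
    with False show ?thesis
      using that[of Q] by (simp add: matrix_vector_mult_scaleR)
  qed
  let ?D = "id_plus_outer \<alpha> \<beta> (norm x *\<^sub>R axis k 1 :: real^'n)"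
  have "det ?D = (\<Prod>i\<in>UNIV. ?D $ i $ i)"
    by (rule det_diagonal) (auto simp: id_plus_outer_def axis_def)
  also have "\<dots> = ?D $ k $ k * (\<Prod>i\<in>UNIV - {k}. ?D $ i $ i)"
    by (rule prod.remove) auto
  also have "(\<Prod>i\<in>UNIV - {k}. ?D $ i $ i) = (\<Prod>i\<in>UNIV - {k}. \<alpha>)"
    by (rule prod.cong) (auto simp: id_plus_outer_def axis_def)
  also have "\<dots> = \<alpha> ^ (CARD('n) - 1)"
    by (simp add: card_Diff_singleton)
  also have "?D $ k $ k = \<alpha> + \<beta> * (x \<bullet> x)"
    by (simp add: id_plus_outer_def dot_square_norm power2_eq_square)
  finally have D: "det ?D = (\<alpha> + \<beta> * (x \<bullet> x)) * \<alpha> ^ (CARD('n) - 1)" .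
  have "det (id_plus_outer \<alpha> \<beta> x) = det (Q ** ?D ** transpose Q)"
    using id_plus_outer_orthogonal[OF Q] Qx by metis
  also have "\<dots> = (det Q)\<^sup>2 * det ?D"
    by (simp add: det_mul det_transpose power2_eq_square)
  also have "(det Q)\<^sup>2 = 1"
    using det_orthogonal_matrix[OF Q] by auto
  finally show ?thesis using D by (simp add: mult.commute)
qed

lemma gram_warped_metric:
  assumes "x \<noteq> 0"
  shows "gram (warped_metric f) x = id_plus_outer (tangential_factor f (x \<bullet> x)) ((1 - tangential_factor f (x \<bullet> x)) / (x \<bullet> x)) x"
  using assms
  by (simp add: gram_def id_plus_outer_def vec_eq_iff warped_metric_eq inner_axis_axis inner_axis)
    (auto simp: axis_def)

lemma ginv_warped_metric:
  assumes "x \<noteq> 0" "tangential_factor f (x \<bullet> x) \<noteq> 0"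
  shows "ginv (warped_metric f) x
    = id_plus_outer (1 / tangential_factor f (x \<bullet> x)) ((1 - 1 / tangential_factor f (x \<bullet> x)) / (x \<bullet> x)) x"
proof -
  have "- ((1 - c) / s) / (c * (c + (1 - c) / s * s)) = (1 - 1 / c) / s" if "c \<noteq> 0" "s \<noteq> 0" for c s :: real
    using that by (simp add: field_simps)
  then show ?thesis
    using assms by (simp add: gram_warped_metric matrix_inv_id_plus_outer)
qed

text \<open>
  The eigenvalue 1 in the radial direction contributes nothing to the determinant; the other
  eigenvalue \<open>(f / \<rho>)\<^sup>2\<close> has multiplicity \<open>n - 1\<close>.
\<close>

lemma vol_density_warped_metric:
  fixes x :: "real^'n::finite"
  assumes "x \<noteq> 0" "f (norm x) \<ge> 0"
  shows "vol_density (warped_metric f) x = (f (norm x) / norm x) ^ (CARD('n) - 1)"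
proof -
  have "tangential_factor f (x \<bullet> x) = (f (norm x) / norm x)\<^sup>2"
    by (simp add: tangential_factor_def dot_square_norm power_divide)
  then have "det (gram (warped_metric f) x) = ((f (norm x) / norm x) ^ (CARD('n) - 1))\<^sup>2"
    using assms(1) by (simp add: gram_warped_metric det_id_plus_outer power_mult[symmetric] mult.commute)
  then show ?thesis
    using assms(2) by (simp add: vol_density_def)
qed

section \<open>Christoffel symbols of the warped metric\<close>

lemma has_derivative_radial:
  fixes x :: "'a::real_inner"
  assumes "(h has_real_derivative h') (at (x \<bullet> x))"
  shows "((\<lambda>y. h (y \<bullet> y)) has_derivative (\<lambda>u. 2 * h' * (x \<bullet> u))) (at x)"
proof -
  have "((\<lambda>y. y \<bullet> y) has_derivative (\<lambda>u. 2 * (x \<bullet> u))) (at x)"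
    by (auto intro!: derivative_eq_intros simp: inner_commute)
  from has_derivative_compose[OF this assms[unfolded has_field_derivative_def]]
  show ?thesis by (simp add: mult_ac)
qed

text \<open>
  With \<open>g\<^sub>i\<^sub>j = A(s) \<delta>\<^sub>i\<^sub>j + B(s) x\<^sub>i x\<^sub>j\<close> and \<open>B = (1 - A) / s\<close>; the number \<open>B'\<close> is the derivative of
  \<open>B\<close> in \<open>s\<close>.
\<close>

lemma pd_gram_warped_metric:
  fixes x :: "real^'n::finite"
  assumes "x \<noteq> 0" "(tangential_factor f has_real_derivative A') (at (x \<bullet> x))"
  defines "s \<equiv> x \<bullet> x"
  defines "B \<equiv> (1 - tangential_factor f s) / s"
  defines "B' \<equiv> - (A' + B) / s"
  shows "pd l (\<lambda>y. gram (warped_metric f) y $ i $ j) x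
    = 2 * A' * x $ l * (if i = j then 1 else 0) + 2 * B' * x $ l * (x $ i * x $ j)
      + B * ((if l = i then 1 else 0) * x $ j + (if l = j then 1 else 0) * x $ i)"
proof -
  have s: "s \<noteq> 0" using assms(1) by (simp add: s_def)
  have A: "(tangential_factor f has_real_derivative A') (at s)"
    using assms(2) by (simp add: s_def)
  have "((\<lambda>s. (1 - tangential_factor f s) / s) has_real_derivative B') (at s)"
    using A s by (auto intro!: derivative_eq_intros simp: B'_def B_def divide_simps)
  then have B: "((\<lambda>y::real^'n. (1 - tangential_factor f (y \<bullet> y)) / (y \<bullet> y)) has_derivative (\<lambda>u. 2 * B' * (x \<bullet> u))) (at x)"
    unfolding s_def by (rule has_derivative_radial)
  have A: "((\<lambda>y::real^'n. tangential_factor f (y \<bullet> y)) has_derivative (\<lambda>u. 2 * A' * (x \<bullet> u))) (at x)"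
    by (rule has_derivative_radial) (rule assms(2))
  have "((\<lambda>y. id_plus_outer (tangential_factor f (y \<bullet> y)) ((1 - tangential_factor f (y \<bullet> y)) / (y \<bullet> y)) y $ i $ j) has_derivative
     (\<lambda>u. 2 * A' * (x \<bullet> u) * (if i = j then 1 else 0) + 2 * B' * (x \<bullet> u) * (x $ i * x $ j)
        + B * (u $ i * x $ j + u $ j * x $ i))) (at x)"
    unfolding id_plus_outer_def vec_lambda_beta
    by (rule has_derivative_eq_rhs, (rule derivative_intros A B bounded_linear_imp_has_derivative bounded_linear_vec_nth)+)
      (simp add: fun_eq_iff algebra_simps B_def s_def)
  then have "((\<lambda>y. gram (warped_metric f) y $ i $ j) has_derivative
     (\<lambda>u. 2 * A' * (x \<bullet> u) * (if i = j then 1 else 0) + 2 * B' * (x \<bullet> u) * (x $ i * x $ j)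
        + B * (u $ i * x $ j + u $ j * x $ i))) (at x)"
    by (rule has_derivative_transform_within_open[where s = "- {0}"])
      (use assms(1) in \<open>auto simp: gram_warped_metric\<close>)
  from pd_eqI[OF this, of l] show ?thesis
    by (simp add: inner_axis) (simp add: axis_def)
qed

text \<open>
  The metric is the identity in the radial direction, so contracting the inverse metric with \<open>x\<close>
  gives back \<open>x\<close>; in coordinates this is \<open>1 / A + D s = 1\<close>, and it collapses most of the terms.
\<close>

lemma christoffel_warped_metric:
  fixes x :: "real^'n::finite"
  assumes x: "x \<noteq> 0" and A': "(tangential_factor f has_real_derivative A') (at (x \<bullet> x))" and "tangential_factor f (x \<bullet> x) \<noteq> 0"
  defines "s \<equiv> x \<bullet> x"
  defines "A \<equiv> tangential_factor f s"
  defines "B \<equiv> (1 - A) / s"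
  defines "B' \<equiv> - (A' + B) / s"
  defines "D \<equiv> (1 - 1 / A) / s"
  shows "christoffel (warped_metric f) k i j x
    = A' / A * (x $ i * (if j = k then 1 else 0) + x $ j * (if i = k then 1 else 0))
      + (B - A') * (if i = j then 1 else 0) * x $ k + (B' + 2 * D * A') * (x $ i * x $ j) * x $ k"
proof -
  have s: "s \<noteq> 0" using x by (simp add: s_def)
  have A: "A \<noteq> 0" using assms(3) by (simp add: A_def s_def)
  define S where "S l = 2 * A' * (x $ i * (if j = l then 1 else 0) + x $ j * (if i = l then 1 else 0)
      - x $ l * (if i = j then 1 else 0)) + 2 * B' * (x $ i * x $ j) * x $ l
      + 2 * B * (if i = j then 1 else 0) * x $ l" for l
  have S: "pd i (\<lambda>y. gram (warped_metric f) y $ j $ l) x + pd j (\<lambda>y. gram (warped_metric f) y $ i $ l) x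
         - pd l (\<lambda>y. gram (warped_metric f) y $ i $ j) x = S l" for l
    unfolding pd_gram_warped_metric[OF x A'] S_def
    by (auto simp: s_def A_def B_def B'_def algebra_simps)
  have xS: "(\<Sum>l\<in>UNIV. x $ l * S l) = 2 * A' * (2 * x $ i * x $ j - s * (if i = j then 1 else 0))
      + 2 * B' * s * (x $ i * x $ j) + 2 * B * s * (if i = j then 1 else 0)"
  proof -
    have "x $ l * S l = (if j = l then 2 * A' * x $ i * x $ l else 0) + (if i = l then 2 * A' * x $ j * x $ l else 0)
      + (2 * B' * (x $ i * x $ j) + (2 * B - 2 * A') * (if i = j then 1 else 0)) * (x $ l * x $ l)" for l
      by (simp add: S_def algebra_simps)
    then show ?thesis
      by (simp add: sum.distrib sum_distrib_left[symmetric] s_def inner_real_vec) (simp add: algebra_simps)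
  qed
  have ginv: "ginv (warped_metric f) x = id_plus_outer (1 / A) D x"
    unfolding A_def D_def s_def by (rule ginv_warped_metric[OF x assms(3)])
  have "christoffel (warped_metric f) k i j x = 1 / 2 * (1 / A * S k + D * x $ k * (\<Sum>l\<in>UNIV. x $ l * S l))"
    unfolding christoffel_def S ginv sum_id_plus_outer ..
  also have "\<dots> = A' / A * (x $ i * (if j = k then 1 else 0) + x $ j * (if i = k then 1 else 0))
      + (1 / A + D * s) * (B - A') * (if i = j then 1 else 0) * x $ k
      + ((1 / A + D * s) * B' + 2 * D * A') * (x $ i * x $ j) * x $ k"
    unfolding xS unfolding S_def using A by (simp add: field_simps)
  also have "1 / A + D * s = 1"
    using s by (simp add: D_def)
  finally show ?thesis by simp
qed

section \<open>The tension field for the warped metric\<close>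

lemma linear_tangent_proj: "linear (tangent_proj y)"
  by (rule linearI) (simp_all add: tangent_proj_def inner_add_left algebra_simps)

text \<open>
  The trace of the covariant Hessian splits into the flat trace, the radial second derivative and a
  first order term.  The last one comes from contracting the Christoffel symbols, and it is a
  multiple of the radial derivative alone by rotational symmetry.
\<close>

lemma tension_warped_metric:
  fixes x :: "real^'n::finite" and \<phi> :: "real^'n \<Rightarrow> 'b::real_inner"
  assumes x: "x \<noteq> 0" and A': "(tangential_factor f has_real_derivative A') (at (x \<bullet> x))" and A0: "tangential_factor f (x \<bullet> x) \<noteq> 0"
  defines "s \<equiv> x \<bullet> x"
  defines "A \<equiv> tangential_factor f s"
  shows "tension (warped_metric f) \<phi> x = tangent_proj (\<phi> x)
    ((1 / A) *\<^sub>R (\<Sum>i\<in>UNIV. pd i (pd i \<phi>) x)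
      + ((1 - 1 / A) / s) *\<^sub>R (\<Sum>i\<in>UNIV. x $ i *\<^sub>R (\<Sum>j\<in>UNIV. x $ j *\<^sub>R pd i (pd j \<phi>) x))
      - ((real CARD('n) - 1) / A * ((1 - A) / s - A')) *\<^sub>R (\<Sum>k\<in>UNIV. x $ k *\<^sub>R pd k \<phi> x))"
proof -
  define B where "B = (1 - A) / s"
  define B' where "B' = - (A' + B) / s"
  define D where "D = (1 - 1 / A) / s"
  \<comment> \<open>The vector \<open>E\<close> is the radial derivative \<open>x \<bullet> \<nabla>\<phi>\<close>, and \<open>G i j\<close> is the Christoffel term of the Hessian.\<close>
  define E where "E = (\<Sum>k\<in>UNIV. x $ k *\<^sub>R pd k \<phi> x)"
  define c where "c = B' + 2 * D * A'"
  have s: "s \<noteq> 0" using x by (simp add: s_def)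
  have A: "A \<noteq> 0" using A0 by (simp add: A_def s_def)
  define G where "G i j = (A' / A) *\<^sub>R (x $ i *\<^sub>R pd j \<phi> x + x $ j *\<^sub>R pd i \<phi> x)
      + ((B - A') * (if i = j then 1 else 0)) *\<^sub>R E + (c * (x $ i * x $ j)) *\<^sub>R E" for i j
  have G: "(\<Sum>k\<in>UNIV. christoffel (warped_metric f) k i j x *\<^sub>R pd k \<phi> x) = G i j" for i j
  proof -
    have "christoffel (warped_metric f) k i j x *\<^sub>R pd k \<phi> x
        = (if j = k then (A' / A * x $ i) *\<^sub>R pd k \<phi> x else 0) + (if i = k then (A' / A * x $ j) *\<^sub>R pd k \<phi> x else 0)
          + ((B - A') * (if i = j then 1 else 0) + c * (x $ i * x $ j)) *\<^sub>R (x $ k *\<^sub>R pd k \<phi> x)" for k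
      unfolding christoffel_warped_metric[OF x A' A0] s_def[symmetric] A_def[symmetric] B_def[symmetric]
        B'_def[symmetric] D_def[symmetric] c_def
      by (simp add: algebra_simps)
    then have "(\<Sum>k\<in>UNIV. christoffel (warped_metric f) k i j x *\<^sub>R pd k \<phi> x)
        = (A' / A * x $ i) *\<^sub>R pd j \<phi> x + (A' / A * x $ j) *\<^sub>R pd i \<phi> x
          + ((B - A') * (if i = j then 1 else 0) + c * (x $ i * x $ j)) *\<^sub>R E"
      by (simp only: sum.distrib scaleR_sum_right[symmetric] E_def[symmetric] sum.delta' sum.delta finite UNIV_I if_True)
    then show ?thesis
      by (simp add: G_def algebra_simps)
  qed
  have xx: "(\<Sum>i\<in>UNIV. (x $ i * x $ i)) = s"
    by (simp add: s_def inner_real_vec)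
  have G1: "(\<Sum>i\<in>UNIV. G i i) = (2 * A' / A + (B - A') * real CARD('n) + c * s) *\<^sub>R E"
  proof -
    have "G i i = (x $ i * x $ i) *\<^sub>R (c *\<^sub>R E) + (A' / A) *\<^sub>R (x $ i *\<^sub>R pd i \<phi> x)
        + (A' / A) *\<^sub>R (x $ i *\<^sub>R pd i \<phi> x) + (B - A') *\<^sub>R E" for i
      by (simp add: G_def algebra_simps)
    then have "(\<Sum>i\<in>UNIV. G i i) = (c * s) *\<^sub>R E + (A' / A) *\<^sub>R E + (A' / A) *\<^sub>R E + real CARD('n) *\<^sub>R ((B - A') *\<^sub>R E)"
      by (simp only: sum.distrib scaleR_sum_left[symmetric] scaleR_sum_right[symmetric] xx E_def[symmetric]
          sum_constant_scaleR) simp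
    also have "\<dots> = (c * s + A' / A + A' / A + real CARD('n) * (B - A')) *\<^sub>R E"
      by (simp only: scaleR_left_distrib scaleR_scaleR)
    also have "c * s + A' / A + A' / A + real CARD('n) * (B - A') = 2 * A' / A + (B - A') * real CARD('n) + c * s"
      by (simp add: algebra_simps)
    finally show ?thesis .
  qed
  have xG: "(\<Sum>j\<in>UNIV. x $ j *\<^sub>R G i j) = (A' / A) *\<^sub>R (x $ i *\<^sub>R E + s *\<^sub>R pd i \<phi> x)
      + ((B - A') * x $ i) *\<^sub>R E + (c * x $ i * s) *\<^sub>R E" for i
  proof -
    have "x $ j *\<^sub>R G i j = (A' / A * x $ i) *\<^sub>R (x $ j *\<^sub>R pd j \<phi> x) + (x $ j * x $ j) *\<^sub>R ((A' / A) *\<^sub>R pd i \<phi> x)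
       + (if i = j then ((B - A') * x $ j) *\<^sub>R E else 0) + (x $ j * x $ j) *\<^sub>R ((c * x $ i) *\<^sub>R E)" for j
      by (simp add: G_def algebra_simps)
    then have "(\<Sum>j\<in>UNIV. x $ j *\<^sub>R G i j) = (A' / A * x $ i) *\<^sub>R E + s *\<^sub>R ((A' / A) *\<^sub>R pd i \<phi> x)
       + ((B - A') * x $ i) *\<^sub>R E + s *\<^sub>R ((c * x $ i) *\<^sub>R E)"
      by (simp only: sum.distrib scaleR_sum_left[symmetric] scaleR_sum_right[symmetric] xx E_def[symmetric]
          sum.delta' sum.delta finite UNIV_I if_True)
    then show ?thesis
      by (simp add: algebra_simps)
  qed
  have "x $ i *\<^sub>R (\<Sum>j\<in>UNIV. x $ j *\<^sub>R G i j)
      = (x $ i * x $ i) *\<^sub>R ((A' / A + (B - A') + c * s) *\<^sub>R E) + (A' / A * s) *\<^sub>R (x $ i *\<^sub>R pd i \<phi> x)" for i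
    unfolding xG by (simp add: algebra_simps)
  then have "(\<Sum>i\<in>UNIV. x $ i *\<^sub>R (\<Sum>j\<in>UNIV. x $ j *\<^sub>R G i j))
      = s *\<^sub>R ((A' / A + (B - A') + c * s) *\<^sub>R E) + (A' / A * s) *\<^sub>R E"
    by (simp only: sum.distrib scaleR_sum_right[symmetric] scaleR_sum_left[symmetric] xx E_def[symmetric])
  also have "\<dots> = (s * (A' / A + (B - A') + c * s) + A' / A * s) *\<^sub>R E"
    unfolding scaleR_scaleR by (rule scaleR_left_distrib[symmetric])
  also have "s * (A' / A + (B - A') + c * s) + A' / A * s = (2 * A' / A + (B - A') + c * s) * s"
    by (simp add: algebra_simps)
  finally have G2: "(\<Sum>i\<in>UNIV. x $ i *\<^sub>R (\<Sum>j\<in>UNIV. x $ j *\<^sub>R G i j))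
      = ((2 * A' / A + (B - A') + c * s) * s) *\<^sub>R E" .
  have coeff: "1 / A * (2 * A' / A + (B - A') * real CARD('n) + c * s) + D * ((2 * A' / A + (B - A') + c * s) * s)
      = (real CARD('n) - 1) / A * (B - A')"
  proof -
    define e where "e = 1 / A"
    have Ds: "D * s = 1 - e" using s by (simp add: D_def e_def)
    have "c * s = B' * s + 2 * (D * s) * A'" by (simp add: c_def algebra_simps)
    also have "B' * s = - (A' + B)" using s by (simp add: B'_def)
    finally have cs: "c * s = - (A' + B) + 2 * (1 - e) * A'" unfolding Ds .
    have "1 / A * (2 * A' / A + (B - A') * real CARD('n) + c * s) + D * ((2 * A' / A + (B - A') + c * s) * s)
      = e * (2 * A' * e + (B - A') * real CARD('n) + c * s) + (D * s) * (2 * A' * e + (B - A') + c * s)"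
      by (simp add: e_def algebra_simps)
    also have "\<dots> = (real CARD('n) - 1) * e * (B - A')"
      unfolding Ds cs by (simp add: algebra_simps)
    finally show ?thesis by (simp add: e_def)
  qed
  have ginv: "ginv (warped_metric f) x = id_plus_outer (1 / A) D x"
    unfolding A_def D_def s_def by (rule ginv_warped_metric[OF x A0])
  define H where "H i j = pd i (pd j \<phi>) x - G i j" for i j
  have "tension (warped_metric f) \<phi> x
      = (\<Sum>i\<in>UNIV. \<Sum>j\<in>UNIV. ginv (warped_metric f) x $ i $ j *\<^sub>R tangent_proj (\<phi> x) (H i j))"
    unfolding tension_def second_fund_form_def cov_hessian_def G H_def ..
  also have "\<dots> = tangent_proj (\<phi> x) (\<Sum>i\<in>UNIV. \<Sum>j\<in>UNIV. ginv (warped_metric f) x $ i $ j *\<^sub>R H i j)"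
    by (simp add: linear_sum[OF linear_tangent_proj] linear_scale[OF linear_tangent_proj])
  also have "(\<Sum>i\<in>UNIV. \<Sum>j\<in>UNIV. ginv (warped_metric f) x $ i $ j *\<^sub>R H i j)
      = (1 / A) *\<^sub>R (\<Sum>i\<in>UNIV. H i i) + D *\<^sub>R (\<Sum>i\<in>UNIV. x $ i *\<^sub>R (\<Sum>j\<in>UNIV. x $ j *\<^sub>R H i j))"
    unfolding ginv sum_id_plus_outer_scaleR by (simp add: sum.distrib scaleR_sum_right mult.assoc)
  also have "\<dots> = (1 / A) *\<^sub>R (\<Sum>i\<in>UNIV. pd i (pd i \<phi>) x)
      + D *\<^sub>R (\<Sum>i\<in>UNIV. x $ i *\<^sub>R (\<Sum>j\<in>UNIV. x $ j *\<^sub>R pd i (pd j \<phi>) x))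
      - ((1 / A) *\<^sub>R (\<Sum>i\<in>UNIV. G i i) + D *\<^sub>R (\<Sum>i\<in>UNIV. x $ i *\<^sub>R (\<Sum>j\<in>UNIV. x $ j *\<^sub>R G i j)))"
    by (simp add: H_def sum_subtractf algebra_simps)
  also have "(1 / A) *\<^sub>R (\<Sum>i\<in>UNIV. G i i) + D *\<^sub>R (\<Sum>i\<in>UNIV. x $ i *\<^sub>R (\<Sum>j\<in>UNIV. x $ j *\<^sub>R G i j))
      = ((real CARD('n) - 1) / A * (B - A')) *\<^sub>R E"
    unfolding G1 G2 scaleR_scaleR scaleR_left_distrib[symmetric] coeff ..
  finally show ?thesis
    by (simp add: D_def B_def E_def)
qed

text \<open>
  Rotationally symmetric maps are \<open>x \<mapsto> (h(s) x, c(s))\<close> with \<open>s = x \<bullet> x\<close>; in this form their partial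
  derivatives are polynomials in the coordinates with functions of \<open>s\<close> as coefficients.
\<close>

lemma pd_radial:
  fixes x :: "real^'n::finite"
  assumes "(h has_real_derivative h1) (at (x \<bullet> x))" "(c has_real_derivative c1) (at (x \<bullet> x))"
  shows "pd i (\<lambda>y. (h (y \<bullet> y) *\<^sub>R y, c (y \<bullet> y))) x
    = ((2 * h1 * x $ i) *\<^sub>R x + h (x \<bullet> x) *\<^sub>R axis i 1, 2 * c1 * x $ i)"
proof -
  have "((\<lambda>y. (h (y \<bullet> y) *\<^sub>R y, c (y \<bullet> y))) has_derivative
      (\<lambda>u. (h (x \<bullet> x) *\<^sub>R u + (2 * h1 * (x \<bullet> u)) *\<^sub>R x, 2 * c1 * (x \<bullet> u)))) (at x)"
    by (intro derivative_intros has_derivative_radial assms)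
  from pd_eqI[OF this, of i] show ?thesis
    by (simp add: inner_axis add.commute)
qed

lemma pd_pd_radial:
  fixes x :: "real^'n::finite"
  assumes S: "open S" "x \<bullet> x \<in> S"
    and "\<And>s. s \<in> S \<Longrightarrow> (h has_real_derivative h1 s) (at s)" "\<And>s. s \<in> S \<Longrightarrow> (c has_real_derivative c1 s) (at s)"
    and h2: "(h1 has_real_derivative h2) (at (x \<bullet> x))" and c2: "(c1 has_real_derivative c2) (at (x \<bullet> x))"
  shows "pd i (pd j (\<lambda>y. (h (y \<bullet> y) *\<^sub>R y, c (y \<bullet> y)))) x
    = ((4 * h2 * (x $ i * x $ j) + 2 * h1 (x \<bullet> x) * (if i = j then 1 else 0)) *\<^sub>R x
        + (2 * h1 (x \<bullet> x)) *\<^sub>R (x $ j *\<^sub>R axis i 1 + x $ i *\<^sub>R axis j 1),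
       4 * c2 * (x $ i * x $ j) + 2 * c1 (x \<bullet> x) * (if i = j then 1 else 0))"
proof -
  let ?F = "\<lambda>y::real^'n. ((2 * h1 (y \<bullet> y) * y $ j) *\<^sub>R y + h (y \<bullet> y) *\<^sub>R axis j 1, 2 * c1 (y \<bullet> y) * y $ j)"
  have h: "(h has_real_derivative h1 (x \<bullet> x)) (at (x \<bullet> x))"
    using assms by blast
  let ?F' = "\<lambda>u. ((4 * h2 * (x \<bullet> u) * x $ j + 2 * h1 (x \<bullet> x) * u $ j) *\<^sub>R x + (2 * h1 (x \<bullet> x) * x $ j) *\<^sub>R u
           + (2 * h1 (x \<bullet> x) * (x \<bullet> u)) *\<^sub>R axis j 1,
         4 * c2 * (x \<bullet> u) * x $ j + 2 * c1 (x \<bullet> x) * u $ j)"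
  have "(?F has_derivative ?F') (at x)"
    by (rule has_derivative_eq_rhs, (rule derivative_intros has_derivative_radial h h2 c2
          bounded_linear_imp_has_derivative bounded_linear_vec_nth)+)
      (simp add: fun_eq_iff algebra_simps)
  moreover have "open {y::real^'n. y \<bullet> y \<in> S}"
    using open_vimage[OF S(1), of "\<lambda>y::real^'n. y \<bullet> y"] by (simp add: vimage_def continuous_on_inner)
  ultimately have "(pd j (\<lambda>y. (h (y \<bullet> y) *\<^sub>R y, c (y \<bullet> y))) has_derivative ?F') (at x)"
    by (rule has_derivative_transform_within_open) (use S in \<open>auto simp: pd_radial[OF assms(3,4)]\<close>)
  from pd_eqI[OF this, of i] show ?thesis
    by (simp add: inner_axis algebra_simps) (simp add: axis_def)
qed

text \<open>
  All vectors involved lie in the plane spanned by \<open>(x, 0)\<close> and \<open>(0, 1)\<close>.  In that plane the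
  component tangent to the unit sphere is a determinant, by Lagrange's identity.
\<close>

lemma norm_tangent_proj_radial:
  fixes x :: "real^'n::finite"
  assumes "h\<^sup>2 * (x \<bullet> x) + c\<^sup>2 = 1"
  shows "(norm (tangent_proj (h *\<^sub>R x, c) (X *\<^sub>R x, Y)))\<^sup>2 = (x \<bullet> x) * (c * X - h * Y)\<^sup>2"
proof -
  define s where "s = x \<bullet> x"
  define p where "p = X * h * s + Y * c"
  have "tangent_proj (h *\<^sub>R x, c) (X *\<^sub>R x, Y) = ((X - p * h) *\<^sub>R x, Y - p * c)"
    by (simp add: tangent_proj_def p_def s_def algebra_simps)
  then have "(norm (tangent_proj (h *\<^sub>R x, c) (X *\<^sub>R x, Y)))\<^sup>2 = (X - p * h)\<^sup>2 * s + (Y - p * c)\<^sup>2"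
    by (simp add: power2_norm_eq_inner s_def) (simp add: power2_eq_square)
  also have "\<dots> = X\<^sup>2 * s + Y\<^sup>2 - 2 * p\<^sup>2 + p\<^sup>2 * (h\<^sup>2 * s + c\<^sup>2)"
    by (simp add: p_def power2_eq_square algebra_simps)
  also have "\<dots> = (X\<^sup>2 * s + Y\<^sup>2) * (h\<^sup>2 * s + c\<^sup>2) - p\<^sup>2"
    using assms by (simp add: s_def)
  also have "\<dots> = s * (c * X - h * Y)\<^sup>2"
    by (simp add: p_def power2_eq_square algebra_simps)
  finally show ?thesis by (simp add: s_def)
qed

text \<open>
  Here \<open>q = m / A\<close>, and \<open>\<kappa>\<close> is the coefficient of the radial derivative in the tension field.
\<close>

lemma norm_tension_radial:
  fixes x :: "real^'n::finite"
  assumes x: "x \<noteq> 0" and A': "(tangential_factor f has_real_derivative A') (at (x \<bullet> x))" and A0: "tangential_factor f (x \<bullet> x) \<noteq> 0"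
    and S: "open S" "x \<bullet> x \<in> S"
    and "\<And>s. s \<in> S \<Longrightarrow> (h has_real_derivative h1 s) (at s)" "\<And>s. s \<in> S \<Longrightarrow> (c has_real_derivative c1 s) (at s)"
    and "(h1 has_real_derivative h2) (at (x \<bullet> x))" "(c1 has_real_derivative c2) (at (x \<bullet> x))"
    and unit: "(h (x \<bullet> x))\<^sup>2 * (x \<bullet> x) + (c (x \<bullet> x))\<^sup>2 = 1"
  defines "s \<equiv> x \<bullet> x"
  defines "q \<equiv> (real CARD('n) - 1) / tangential_factor f s"
  defines "\<kappa> \<equiv> q * ((1 - tangential_factor f s) / s - A')"
  shows "(norm (tension (warped_metric f) (\<lambda>y. (h (y \<bullet> y) *\<^sub>R y, c (y \<bullet> y))) x))\<^sup>2
    = s * (c s * (4 * h2 * s + 2 * h1 s * (q + 3) - \<kappa> * (2 * h1 s * s + h s))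
        - h s * (4 * c2 * s + 2 * c1 s * (q + 1) - \<kappa> * (2 * c1 s * s)))\<^sup>2"
proof -
  let ?\<phi> = "\<lambda>y::real^'n. (h (y \<bullet> y) *\<^sub>R y, c (y \<bullet> y))"
  define A where "A = tangential_factor f s"
  define D where "D = (1 - 1 / A) / s"
  have s0: "s \<noteq> 0" using x by (simp add: s_def)
  have A: "A \<noteq> 0" using A0 by (simp add: A_def s_def)
  have AD: "1 / A + D * s = 1" using s0 by (simp add: D_def)
  have xx: "(\<Sum>i\<in>UNIV. x $ i * x $ i) = s"
    by (simp add: s_def inner_real_vec)
  have xe: "(\<Sum>i\<in>UNIV. x $ i *\<^sub>R axis i 1) = x"
    by (simp add: vec_eq_iff axis_def if_distrib cong: if_cong)
  have pd1: "pd k ?\<phi> x = ((2 * h1 s * x $ k) *\<^sub>R x + h s *\<^sub>R axis k 1, 2 * c1 s * x $ k)" for k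
    unfolding s_def by (rule pd_radial) (use assms in auto)
  have pd2: "pd i (pd j ?\<phi>) x = ((4 * h2 * (x $ i * x $ j) + 2 * h1 s * (if i = j then 1 else 0)) *\<^sub>R x
        + (2 * h1 s) *\<^sub>R (x $ j *\<^sub>R axis i 1 + x $ i *\<^sub>R axis j 1),
       4 * c2 * (x $ i * x $ j) + 2 * c1 s * (if i = j then 1 else 0))" for i j
    unfolding s_def by (rule pd_pd_radial[OF S]) (use assms in auto)
  have E: "(\<Sum>k\<in>UNIV. x $ k *\<^sub>R pd k ?\<phi> x) = ((2 * h1 s * s + h s) *\<^sub>R x, 2 * c1 s * s)"
  proof -
    have "x $ k *\<^sub>R pd k ?\<phi> x = (x $ k * x $ k) *\<^sub>R ((2 * h1 s) *\<^sub>R x, 2 * c1 s) + h s *\<^sub>R (x $ k *\<^sub>R axis k 1, 0)" for k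
      by (simp add: pd1 algebra_simps)
    then have "(\<Sum>k\<in>UNIV. x $ k *\<^sub>R pd k ?\<phi> x)
        = s *\<^sub>R ((2 * h1 s) *\<^sub>R x, 2 * c1 s) + h s *\<^sub>R (\<Sum>k\<in>UNIV. (x $ k *\<^sub>R axis k 1, 0))"
      by (simp only: sum.distrib scaleR_sum_left[symmetric] scaleR_sum_right[symmetric] xx)
    then show ?thesis
      by (simp add: sum_prod xe algebra_simps)
  qed
  have tr: "(\<Sum>i\<in>UNIV. pd i (pd i ?\<phi>) x)
      = ((4 * h2 * s + 2 * h1 s * (real CARD('n) + 2)) *\<^sub>R x, 4 * c2 * s + 2 * c1 s * real CARD('n))"
  proof -
    have "pd i (pd i ?\<phi>) x = (x $ i * x $ i) *\<^sub>R ((4 * h2) *\<^sub>R x, 4 * c2) + ((2 * h1 s) *\<^sub>R x, 2 * c1 s)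
        + (2 * h1 s) *\<^sub>R (x $ i *\<^sub>R axis i 1, 0) + (2 * h1 s) *\<^sub>R (x $ i *\<^sub>R axis i 1, 0)" for i
      by (simp add: pd2 algebra_simps)
    then have "(\<Sum>i\<in>UNIV. pd i (pd i ?\<phi>) x)
        = s *\<^sub>R ((4 * h2) *\<^sub>R x, 4 * c2) + real CARD('n) *\<^sub>R ((2 * h1 s) *\<^sub>R x, 2 * c1 s)
        + (2 * h1 s) *\<^sub>R (\<Sum>i\<in>UNIV. (x $ i *\<^sub>R axis i 1, 0)) + (2 * h1 s) *\<^sub>R (\<Sum>i\<in>UNIV. (x $ i *\<^sub>R axis i 1, 0))"
      by (simp only: sum.distrib scaleR_sum_left[symmetric] scaleR_sum_right[symmetric] xx sum_constant_scaleR)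
    also have "\<dots> = ((s * (4 * h2) + real CARD('n) * (2 * h1 s) + 2 * h1 s + 2 * h1 s) *\<^sub>R x,
        s * (4 * c2) + real CARD('n) * (2 * c1 s))"
      unfolding sum_prod xe fst_conv snd_conv sum.neutral_const
      by (simp only: scaleR_Pair add_Pair scaleR_left_distrib scaleR_scaleR scaleR_zero_right add_0_right real_scaleR_def mult_zero_right)
    finally show ?thesis
      by (simp add: algebra_simps)
  qed
  have rad: "(\<Sum>i\<in>UNIV. x $ i *\<^sub>R (\<Sum>j\<in>UNIV. x $ j *\<^sub>R pd i (pd j ?\<phi>) x))
      = s *\<^sub>R ((4 * h2 * s + 6 * h1 s) *\<^sub>R x, 4 * c2 * s + 2 * c1 s)"
  proof -
    have "(\<Sum>j\<in>UNIV. x $ j *\<^sub>R pd i (pd j ?\<phi>) x) = ((4 * h2 * s + 4 * h1 s) * x $ i) *\<^sub>R (x, 0)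
        + (2 * h1 s * s) *\<^sub>R (axis i 1, 0) + x $ i *\<^sub>R (0, 4 * c2 * s + 2 * c1 s)" for i
    proof -
      have "x $ j *\<^sub>R pd i (pd j ?\<phi>) x = (x $ j * x $ j) *\<^sub>R ((4 * h2 * x $ i) *\<^sub>R x + (2 * h1 s) *\<^sub>R axis i 1, 4 * c2 * x $ i)
          + (if i = j then x $ j *\<^sub>R ((2 * h1 s) *\<^sub>R x, 2 * c1 s) else 0)
          + (2 * h1 s * x $ i) *\<^sub>R (x $ j *\<^sub>R axis j 1, 0)" for j
        by (simp add: pd2 algebra_simps)
      then have "(\<Sum>j\<in>UNIV. x $ j *\<^sub>R pd i (pd j ?\<phi>) x)
        = s *\<^sub>R ((4 * h2 * x $ i) *\<^sub>R x + (2 * h1 s) *\<^sub>R axis i 1, 4 * c2 * x $ i)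
          + x $ i *\<^sub>R ((2 * h1 s) *\<^sub>R x, 2 * c1 s)
          + (2 * h1 s * x $ i) *\<^sub>R (\<Sum>j\<in>UNIV. (x $ j *\<^sub>R axis j 1, 0))"
        by (simp only: sum.distrib scaleR_sum_left[symmetric] scaleR_sum_right[symmetric] xx sum.delta' sum.delta
            finite UNIV_I if_True)
      then show ?thesis
        by (simp add: sum_prod xe vec_eq_iff algebra_simps)
    qed
    then have "x $ i *\<^sub>R (\<Sum>j\<in>UNIV. x $ j *\<^sub>R pd i (pd j ?\<phi>) x)
        = (x $ i * x $ i) *\<^sub>R ((4 * h2 * s + 4 * h1 s) *\<^sub>R x, 4 * c2 * s + 2 * c1 s)
          + (2 * h1 s * s) *\<^sub>R (x $ i *\<^sub>R axis i 1, 0)" for i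
      by (simp add: algebra_simps)
    then have "(\<Sum>i\<in>UNIV. x $ i *\<^sub>R (\<Sum>j\<in>UNIV. x $ j *\<^sub>R pd i (pd j ?\<phi>) x))
        = s *\<^sub>R ((4 * h2 * s + 4 * h1 s) *\<^sub>R x, 4 * c2 * s + 2 * c1 s)
          + (2 * h1 s * s) *\<^sub>R (\<Sum>i\<in>UNIV. (x $ i *\<^sub>R axis i 1, 0))"
      by (simp only: sum.distrib scaleR_sum_left[symmetric] scaleR_sum_right[symmetric] xx)
    then show ?thesis
      by (simp add: sum_prod xe vec_eq_iff algebra_simps)
  qed
  have "tension (warped_metric f) ?\<phi> x = tangent_proj (h s *\<^sub>R x, c s)
      ((1 / A) *\<^sub>R (\<Sum>i\<in>UNIV. pd i (pd i ?\<phi>) x)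
      + D *\<^sub>R (\<Sum>i\<in>UNIV. x $ i *\<^sub>R (\<Sum>j\<in>UNIV. x $ j *\<^sub>R pd i (pd j ?\<phi>) x))
      - \<kappa> *\<^sub>R (\<Sum>k\<in>UNIV. x $ k *\<^sub>R pd k ?\<phi> x))"
    unfolding tension_warped_metric[OF x A' A0] A_def D_def \<kappa>_def q_def s_def ..
  also have "(1 / A) *\<^sub>R (\<Sum>i\<in>UNIV. pd i (pd i ?\<phi>) x)
      + D *\<^sub>R (\<Sum>i\<in>UNIV. x $ i *\<^sub>R (\<Sum>j\<in>UNIV. x $ j *\<^sub>R pd i (pd j ?\<phi>) x))
      - \<kappa> *\<^sub>R (\<Sum>k\<in>UNIV. x $ k *\<^sub>R pd k ?\<phi> x)
    = ((1 / A * (4 * h2 * s + 2 * h1 s * (real CARD('n) + 2)) + D * s * (4 * h2 * s + 6 * h1 s)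
          - \<kappa> * (2 * h1 s * s + h s)) *\<^sub>R x,
       1 / A * (4 * c2 * s + 2 * c1 s * real CARD('n)) + D * s * (4 * c2 * s + 2 * c1 s) - \<kappa> * (2 * c1 s * s))"
    unfolding tr rad E by (simp add: algebra_simps)
  also have "1 / A * (4 * h2 * s + 2 * h1 s * (real CARD('n) + 2)) + D * s * (4 * h2 * s + 6 * h1 s)
      = (1 / A + D * s) * (4 * h2 * s + 6 * h1 s) + 2 * h1 s * q"
    by (simp add: q_def A_def algebra_simps diff_divide_distrib)
  also have "1 / A * (4 * c2 * s + 2 * c1 s * real CARD('n)) + D * s * (4 * c2 * s + 2 * c1 s)
      = (1 / A + D * s) * (4 * c2 * s + 2 * c1 s) + 2 * c1 s * q"
    by (simp add: q_def A_def algebra_simps diff_divide_distrib)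
  finally have T: "tension (warped_metric f) ?\<phi> x = tangent_proj (h s *\<^sub>R x, c s)
      ((4 * h2 * s + 2 * h1 s * (q + 3) - \<kappa> * (2 * h1 s * s + h s)) *\<^sub>R x,
       4 * c2 * s + 2 * c1 s * (q + 1) - \<kappa> * (2 * c1 s * s))"
    unfolding AD by (simp add: algebra_simps)
  show ?thesis
    unfolding T s_def
    by (rule norm_tangent_proj_radial) (rule unit)
qed

section \<open>Rotationally symmetric maps into the sphere\<close>

text \<open>
  The substitution \<open>h = sin \<alpha> / r\<close>, \<open>c = cos \<alpha>\<close> in the formula for the tension, with \<open>r = \<surd>s\<close>.  The squares
  of \<open>\<alpha>'\<close> cancel and the remaining terms combine through \<open>sin\<^sup>2 \<alpha> + cos\<^sup>2 \<alpha> = 1\<close>.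
\<close>

lemma rotational_tension_algebra:
  fixes r sn cs a1 a2 q \<kappa> :: real
  assumes "r \<noteq> 0" and sc: "sn\<^sup>2 + cs\<^sup>2 = 1"
    and H: "H = sn / r" and H1: "H1 = cs * a1 / r - sn / (2 * r ^ 3)"
    and H2: "H2 = (cs * a2 - sn * a1\<^sup>2) / r - cs * a1 / r ^ 3 + 3 * sn / (4 * r ^ 5)"
    and C1: "C1 = - (sn * a1)" and C2: "C2 = - (cs * a1\<^sup>2) - sn * a2"
  shows "r * (cs * (4 * H2 * r\<^sup>2 + 2 * H1 * (q + 3) - \<kappa> * (2 * H1 * r\<^sup>2 + H))
        - H * (4 * C2 * r\<^sup>2 + 2 * C1 * (q + 1) - \<kappa> * (2 * C1 * r\<^sup>2)))
    = 4 * r\<^sup>2 * a2 + 2 * (q + 1) * a1 - 2 * r\<^sup>2 * \<kappa> * a1 - q * sn * cs / r\<^sup>2"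
proof -
  define X where "X = 4 * H2 * r\<^sup>2 + 2 * H1 * (q + 3) - \<kappa> * (2 * H1 * r\<^sup>2 + H)"
  define Y where "Y = 4 * C2 * r\<^sup>2 + 2 * C1 * (q + 1) - \<kappa> * (2 * C1 * r\<^sup>2)"
  have rX: "r * X
      = 4 * r\<^sup>2 * (cs * a2 - sn * a1\<^sup>2) + 2 * (q + 1) * cs * a1 - q * sn / r\<^sup>2 - 2 * \<kappa> * r\<^sup>2 * cs * a1"
    unfolding X_def H H1 H2 using \<open>r \<noteq> 0\<close>
    by (simp add: divide_simps power2_eq_square eval_nat_numeral) (simp add: algebra_simps)
  have rH: "r * H = sn" using \<open>r \<noteq> 0\<close> by (simp add: H)
  have "r * (cs * X - H * Y) = cs * (r * X) - (r * H) * Y"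
    by (simp add: algebra_simps)
  also have "\<dots> = (sn\<^sup>2 + cs\<^sup>2) * (4 * r\<^sup>2 * a2 + 2 * (q + 1) * a1 - 2 * r\<^sup>2 * \<kappa> * a1) - q * sn * cs / r\<^sup>2"
    unfolding rX rH Y_def C1 C2 by (simp add: algebra_simps power2_eq_square)
  finally show ?thesis by (simp add: sc X_def Y_def)
qed

lemma has_real_derivative_sqrt:
  assumes "s > 0"
  shows "(sqrt has_real_derivative 1 / (2 * sqrt s)) (at s)"
  by (rule DERIV_cong[OF DERIV_real_sqrt[OF assms]]) (simp add: field_simps)

lemma has_real_derivative_tangential_factor:
  assumes "r > 0" "(f has_real_derivative f1) (at r)"
  shows "(tangential_factor f has_real_derivative f r * f1 / r ^ 3 - (f r)\<^sup>2 / r ^ 4) (at (r\<^sup>2))"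
proof -
  have sq: "(sqrt has_real_derivative 1 / (2 * r)) (at (r\<^sup>2))"
    using has_real_derivative_sqrt[of "r\<^sup>2"] assms(1) by simp
  have "(f has_real_derivative f1) (at (sqrt (r\<^sup>2)))" using assms by simp
  from DERIV_chain2[OF this sq]
  have f: "((\<lambda>s. f (sqrt s)) has_real_derivative f1 * (1 / (2 * r))) (at (r\<^sup>2))" .
  show ?thesis
    unfolding tangential_factor_def[abs_def]
    by (rule DERIV_cong[OF DERIV_divide[OF DERIV_power[OF f] DERIV_ident]])
      (use assms(1) in \<open>simp_all add: divide_simps eval_nat_numeral\<close>)
qed

text \<open>
  Here \<open>\<alpha>1\<close> and \<open>\<alpha>2\<close> are derivatives in \<open>s = r\<^sup>2\<close>; since \<open>d/dr = 2 r d/ds\<close>, the first two terms are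
  the second derivative of the angle in \<open>r\<close>, and \<open>2 r \<alpha>1\<close> is the first one.
\<close>

lemma norm_tension_sphere_point:
  fixes x :: "real^'n::finite"
  assumes x: "x \<noteq> 0" and f: "(f has_real_derivative f1) (at (norm x))" and f0: "f (norm x) > 0"
    and S: "open S" "S \<subseteq> {0<..}" "x \<bullet> x \<in> S"
    and \<alpha>: "\<And>s. s \<in> S \<Longrightarrow> (\<alpha> has_real_derivative \<alpha>1 s) (at s)"
    and \<alpha>1: "\<And>s. s \<in> S \<Longrightarrow> (\<alpha>1 has_real_derivative \<alpha>2 s) (at s)"
  defines "r \<equiv> norm x" and "m \<equiv> real CARD('n) - 1"
  shows "(norm (tension (warped_metric f) (\<lambda>y. sphere_point (y /\<^sub>R norm y) (\<alpha> (y \<bullet> y))) x))\<^sup>2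
    = (4 * r\<^sup>2 * \<alpha>2 (r\<^sup>2) + 2 * \<alpha>1 (r\<^sup>2) + 2 * m * r * f1 / f r * \<alpha>1 (r\<^sup>2)
        - m * sin (\<alpha> (r\<^sup>2)) * cos (\<alpha> (r\<^sup>2)) / (f r)\<^sup>2)\<^sup>2"
proof -
  have r: "r > 0" using x by (simp add: r_def)
  have xx: "x \<bullet> x = r\<^sup>2" by (simp add: r_def dot_square_norm)
  \<comment> \<open>A name for the square root keeps the simplifier from rewriting its powers, so that the formulas stay rational in \<open>g s\<close>.\<close>
  define g where "g = (sqrt :: real \<Rightarrow> real)"
  define h where "h s = sin (\<alpha> s) / g s" for s
  define h1 where "h1 s = cos (\<alpha> s) * \<alpha>1 s / g s - sin (\<alpha> s) / (2 * (g s) ^ 3)" for s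
  define h2 where "h2 s = (cos (\<alpha> s) * \<alpha>2 s - sin (\<alpha> s) * (\<alpha>1 s)\<^sup>2) / g s - cos (\<alpha> s) * \<alpha>1 s / (g s) ^ 3
    + 3 * sin (\<alpha> s) / (4 * (g s) ^ 5)" for s
  define c where "c s = cos (\<alpha> s)" for s
  define c1 where "c1 s = - (sin (\<alpha> s) * \<alpha>1 s)" for s
  define c2 where "c2 s = - (cos (\<alpha> s) * (\<alpha>1 s)\<^sup>2) - sin (\<alpha> s) * \<alpha>2 s" for s
  have g: "(g has_real_derivative 1 / (2 * g s)) (at s)" "g s \<noteq> 0" if "s \<in> S" for s
    using that S(2) by (auto simp: g_def intro!: has_real_derivative_sqrt)
  have gr: "g (r\<^sup>2) = r" using r by (simp add: g_def)
  have h: "(h has_real_derivative h1 s) (at s)" if s: "s \<in> S" for s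
    unfolding h_def h1_def
    by (auto intro!: derivative_eq_intros \<alpha>[OF s] g[OF s])
      (use g(2)[OF s] in \<open>simp add: divide_simps eval_nat_numeral\<close>)
  have h1: "(h1 has_real_derivative h2 s) (at s)" if s: "s \<in> S" for s
    unfolding h1_def h2_def
    by (auto intro!: derivative_eq_intros \<alpha>[OF s] \<alpha>1[OF s] g[OF s] simp: g(2)[OF s])
      (use g(2)[OF s] in \<open>simp add: divide_simps eval_nat_numeral, simp add: algebra_simps\<close>)
  have c: "(c has_real_derivative c1 s) (at s)" if s: "s \<in> S" for s
    unfolding c_def c1_def by (auto intro!: derivative_eq_intros \<alpha>[OF s])
  have c1: "(c1 has_real_derivative c2 s) (at s)" if s: "s \<in> S" for s
    unfolding c1_def c2_def by (auto intro!: derivative_eq_intros \<alpha>[OF s] \<alpha>1[OF s] simp: algebra_simps power2_eq_square)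
  define A' where "A' = f r * f1 / r ^ 3 - (f r)\<^sup>2 / r ^ 4"
  have A': "(tangential_factor f has_real_derivative A') (at (x \<bullet> x))"
    unfolding xx A'_def by (rule has_real_derivative_tangential_factor[OF r]) (use f in \<open>simp add: r_def\<close>)
  have A: "tangential_factor f (r\<^sup>2) = (f r)\<^sup>2 / r\<^sup>2"
    using r by (simp add: tangential_factor_def)
  have A0: "tangential_factor f (x \<bullet> x) \<noteq> 0"
    unfolding xx A using r f0 by (simp add: r_def)
  have \<phi>: "(\<lambda>y::real^'n. sphere_point (y /\<^sub>R norm y) (\<alpha> (y \<bullet> y))) = (\<lambda>y. (h (y \<bullet> y) *\<^sub>R y, c (y \<bullet> y)))"
    by (simp add: sphere_point_def h_def g_def c_def norm_eq_sqrt_inner divide_inverse fun_eq_iff)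
  have unit: "(h (x \<bullet> x))\<^sup>2 * (x \<bullet> x) + (c (x \<bullet> x))\<^sup>2 = 1"
    unfolding xx h_def c_def gr using r by (simp add: power_divide)
  define q where "q = m / tangential_factor f (r\<^sup>2)"
  define \<kappa> where "\<kappa> = q * ((1 - tangential_factor f (r\<^sup>2)) / r\<^sup>2 - A')"
  have "(norm (tension (warped_metric f) (\<lambda>y. sphere_point (y /\<^sub>R norm y) (\<alpha> (y \<bullet> y))) x))\<^sup>2
     = r\<^sup>2 * (c (r\<^sup>2) * (4 * h2 (r\<^sup>2) * r\<^sup>2 + 2 * h1 (r\<^sup>2) * (q + 3) - \<kappa> * (2 * h1 (r\<^sup>2) * r\<^sup>2 + h (r\<^sup>2)))
        - h (r\<^sup>2) * (4 * c2 (r\<^sup>2) * r\<^sup>2 + 2 * c1 (r\<^sup>2) * (q + 1) - \<kappa> * (2 * c1 (r\<^sup>2) * r\<^sup>2)))\<^sup>2"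
    unfolding \<phi> q_def \<kappa>_def m_def xx[symmetric]
    by (rule norm_tension_radial[OF x A' A0 S(1,3) h c h1[OF S(3)] c1[OF S(3)] unit])
  also have "\<dots> = (r * (c (r\<^sup>2) * (4 * h2 (r\<^sup>2) * r\<^sup>2 + 2 * h1 (r\<^sup>2) * (q + 3) - \<kappa> * (2 * h1 (r\<^sup>2) * r\<^sup>2 + h (r\<^sup>2)))
        - h (r\<^sup>2) * (4 * c2 (r\<^sup>2) * r\<^sup>2 + 2 * c1 (r\<^sup>2) * (q + 1) - \<kappa> * (2 * c1 (r\<^sup>2) * r\<^sup>2))))\<^sup>2"
    by (simp add: power_mult_distrib)
  also have "r * (c (r\<^sup>2) * (4 * h2 (r\<^sup>2) * r\<^sup>2 + 2 * h1 (r\<^sup>2) * (q + 3) - \<kappa> * (2 * h1 (r\<^sup>2) * r\<^sup>2 + h (r\<^sup>2)))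
        - h (r\<^sup>2) * (4 * c2 (r\<^sup>2) * r\<^sup>2 + 2 * c1 (r\<^sup>2) * (q + 1) - \<kappa> * (2 * c1 (r\<^sup>2) * r\<^sup>2)))
    = 4 * r\<^sup>2 * \<alpha>2 (r\<^sup>2) + 2 * (q + 1) * \<alpha>1 (r\<^sup>2) - 2 * r\<^sup>2 * \<kappa> * \<alpha>1 (r\<^sup>2)
        - q * sin (\<alpha> (r\<^sup>2)) * cos (\<alpha> (r\<^sup>2)) / r\<^sup>2"
    unfolding c_def by (rule rotational_tension_algebra) (use r in \<open>simp_all add: gr h_def h1_def h2_def c1_def c2_def\<close>)
  also have "\<dots> = 4 * r\<^sup>2 * \<alpha>2 (r\<^sup>2) + 2 * \<alpha>1 (r\<^sup>2) + 2 * (q - r\<^sup>2 * \<kappa>) * \<alpha>1 (r\<^sup>2)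
        - (q / r\<^sup>2) * sin (\<alpha> (r\<^sup>2)) * cos (\<alpha> (r\<^sup>2))"
    by (simp add: algebra_simps)
  also have "q / r\<^sup>2 = m / (f r)\<^sup>2"
    unfolding q_def A using r by simp
  also have "q - r\<^sup>2 * \<kappa> = m * r * f1 / f r"
    unfolding \<kappa>_def q_def A A'_def using r f0[folded r_def]
    by (simp add: divide_simps eval_nat_numeral) (simp add: algebra_simps)
  finally show ?thesis
    by (simp add: mult.assoc)
qed

section \<open>Integrals of radial functions over shells\<close>

text \<open>
  The norm transports Lebesgue measure on a ball to the measure on the line with density
  \<open>\<omega> d r\<^sup>d\<^sup>-\<^sup>1\<close>, where \<open>\<omega>\<close> is the volume of the unit ball: both give the same value to every half-line,
  by the formula for the volume of balls.
\<close>

lemma distr_norm_lborel_cball: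
  fixes v :: real
  assumes v: "0 \<le> v"
  defines "d \<equiv> DIM('a::euclidean_space)"
  shows "distr (density lborel (\<lambda>x::'a. ennreal (indicator (cball 0 v) x))) borel norm
    = density lborel (\<lambda>r. ennreal (unit_ball_vol d * (real d * r ^ (d - 1)) * indicator {0..v} r))"
    (is "?M = ?N")
proof (rule measure_eqI_lessThan)
  fix y :: real
  have [measurable]: "cball (0::'a) v \<in> sets borel" by simp
  have d: "d > 0" by (simp add: d_def)
  have "emeasure ?M {y<..} = emeasure (density lborel (\<lambda>x::'a. ennreal (indicator (cball 0 v) x))) {x. y < norm x}"
    by (subst emeasure_distr) (auto simp: vimage_def)
  also have "\<dots> = (\<integral>\<^sup>+x. ennreal (indicator (cball 0 v) x) * indicator {x::'a. y < norm x} x \<partial>lborel)"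
    by (rule emeasure_density) auto
  also have "\<dots> = (\<integral>\<^sup>+x. indicator {x::'a. norm x \<le> v \<and> y < norm x} x \<partial>lborel)"
    by (rule nn_integral_cong) (simp add: indicator_def)
  also have "\<dots> = emeasure lborel {x::'a. norm x \<le> v \<and> y < norm x}"
    by (rule nn_integral_indicator) simp
  finally have M: "emeasure ?M {y<..} = emeasure lborel {x::'a. norm x \<le> v \<and> y < norm x}" .
  have N: "emeasure ?N {y<..} = (\<integral>\<^sup>+r. ennreal (unit_ball_vol d * (real d * r ^ (d - 1)) * indicator {0..v} r)
      * indicator {y<..} r \<partial>lborel)"
    by (rule emeasure_density) auto
  have eq: "emeasure ?M {y<..} = emeasure ?N {y<..} \<and> emeasure ?M {y<..} < \<infinity>"
  proof (cases "y \<le> v")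
    case False
    then have "{x::'a. norm x \<le> v \<and> y < norm x} = {}" by auto
    then have "emeasure ?M {y<..} = 0" unfolding M by (simp only: emeasure_empty)
    moreover have "emeasure ?N {y<..} = (\<integral>\<^sup>+r. 0 \<partial>(lborel :: real measure))"
      unfolding N by (rule nn_integral_cong) (use False in \<open>auto simp: indicator_def\<close>)
    ultimately show ?thesis by simp
  next
    case True
    define z where "z = max 0 y"
    have z: "0 \<le> z" "z \<le> v" using True v by (auto simp: z_def)
    have "emeasure ?M {y<..} = unit_ball_vol d * (v ^ d - z ^ d)"
    proof (cases "y < 0")
      case True
      then have "{x::'a. norm x \<le> v \<and> y < norm x} = cball 0 v"
        by (auto intro: less_le_trans)
      then show ?thesis
        unfolding M using True v d by (simp add: emeasure_cball d_def z_def)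
    next
      case False
      then have "{x::'a. norm x \<le> v \<and> y < norm x} = cball 0 v - cball 0 z"
        by (auto simp: z_def)
      moreover have "emeasure lborel (cball 0 v - cball (0::'a) z) = emeasure lborel (cball (0::'a) v) - emeasure lborel (cball (0::'a) z)"
        by (rule emeasure_Diff) (use z in \<open>auto simp: emeasure_cball\<close>)
      ultimately show ?thesis
        unfolding M using z by (simp add: emeasure_cball d_def ennreal_minus right_diff_distrib)
    qed
    moreover have "emeasure ?N {y<..} = unit_ball_vol d * (v ^ d - z ^ d)"
    proof -
      have "emeasure ?N {y<..} = (\<integral>\<^sup>+r. ennreal (unit_ball_vol d * (real d * r ^ (d - 1))) * indicator {z..v} r \<partial>lborel)"
        unfolding N
      proof (rule nn_integral_cong_AE)
        have "AE r in lborel. r \<noteq> y" by (rule AE_lborel_singleton)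
        then show "AE r in lborel. ennreal (unit_ball_vol d * (real d * r ^ (d - 1)) * indicator {0..v} r)
          * indicator {y<..} r = ennreal (unit_ball_vol d * (real d * r ^ (d - 1))) * indicator {z..v} r"
          by eventually_elim (auto simp: indicator_def z_def)
      qed
      also have "\<dots> = ennreal (unit_ball_vol d * v ^ d - unit_ball_vol d * z ^ d)"
        by (rule nn_integral_FTC_Icc) (use z in \<open>auto intro!: derivative_eq_intros\<close>)
      finally show ?thesis by (simp add: right_diff_distrib)
    qed
    ultimately show ?thesis by simp
  qed
  then show "emeasure ?M {y<..} < \<infinity>" "emeasure ?M {y<..} = emeasure ?N {y<..}" by auto
qed simp_all

lemma radial_integral:
  fixes u v :: real and G :: "real \<Rightarrow> real"
  assumes "0 \<le> u" "u \<le> v" and G: "continuous_on {u..v} G"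
  defines "d \<equiv> DIM('a::euclidean_space)"
  shows "(LINT x:{x::'a. u \<le> norm x \<and> norm x \<le> v}|lborel. G (norm x))
    = real d * unit_ball_vol d * integral {u..v} (\<lambda>r. G r * r ^ (d - 1))"
proof -
  define g where "g r = indicator {u..v} r *\<^sub>R G r" for r
  have [measurable]: "g \<in> borel_measurable borel"
    unfolding g_def[abs_def] by (rule borel_measurable_continuous_on_indicator[OF _ G]) simp
  define w where "w r = unit_ball_vol d * (real d * r ^ (d - 1))" for r :: real
  have [measurable]: "w \<in> borel_measurable borel" by (simp add: w_def[abs_def])
  have [measurable]: "cball (0::'a) v \<in> sets borel" by simp
  have "(LINT x:{x::'a. u \<le> norm x \<and> norm x \<le> v}|lborel. G (norm x))
      = (\<integral>x. indicator (cball 0 v) x *\<^sub>R g (norm x) \<partial>(lborel :: 'a measure))"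
    unfolding set_lebesgue_integral_def by (rule Bochner_Integration.integral_cong) (auto simp: g_def indicator_def)
  also have "\<dots> = (\<integral>x. g (norm x) \<partial>density lborel (\<lambda>x::'a. ennreal (indicator (cball 0 v) x)))"
    by (rule integral_density[symmetric]) auto
  also have "\<dots> = (\<integral>r. g r \<partial>distr (density lborel (\<lambda>x::'a. ennreal (indicator (cball 0 v) x))) borel norm)"
    by (rule integral_distr[symmetric]) auto
  also have "\<dots> = (\<integral>r. g r \<partial>density lborel (\<lambda>r. ennreal (w r * indicator {0..v} r)))"
    unfolding w_def d_def using assms by (subst distr_norm_lborel_cball) auto
  also have "\<dots> = (\<integral>r. (w r * indicator {0..v} r) *\<^sub>R g r \<partial>lborel)"
    by (rule integral_density) (auto simp: w_def indicator_def)
  also have "\<dots> = (LINT r:{u..v}|lborel. w r * G r)"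
    unfolding set_lebesgue_integral_def
    by (rule Bochner_Integration.integral_cong) (use assms in \<open>auto simp: g_def indicator_def\<close>)
  also have "\<dots> = integral {u..v} (\<lambda>r. w r * G r)"
  proof (rule set_borel_integral_eq_integral)
    show "set_integrable lborel {u..v} (\<lambda>r. w r * G r)"
      unfolding set_integrable_def
      by (rule borel_integrable_compact) (auto simp: w_def intro!: continuous_intros G)
  qed
  also have "\<dots> = integral {u..v} (\<lambda>r. (real d * unit_ball_vol d) * (G r * r ^ (d - 1)))"
    by (simp add: w_def mult_ac)
  finally show ?thesis by simp
qed

section \<open>The bienergy of rotationally symmetric maps\<close>

text \<open>
  The only factor that is singular at the pole is \<open>1 / |x|\<close>, a real power of \<open>x \<bullet> x\<close>, which is
  positive on the punctured ball.
\<close>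

lemma smooth_on_radial_variation:
  fixes a :: real
  assumes \<beta>: "smooth_on UNIV \<beta>"
  shows "smooth_on ({-\<epsilon><..<\<epsilon>} \<times> (ball 0 1 - {0::real^'n::finite}))
    (\<lambda>(t, x). sphere_point (x /\<^sub>R norm x) (a + t * \<beta> (x \<bullet> x)))"
proof -
  let ?T = "{-\<epsilon><..<\<epsilon>} \<times> (ball 0 1 - {0::real^'n})"
  have T: "open ?T" by (intro open_Times) auto
  have fst: "smooth_on ?T fst" and snd: "smooth_on ?T snd"
    by (intro smooth_on_bounded_linear T bounded_linear_fst bounded_linear_snd)+
  have sq: "smooth_on ?T (\<lambda>z. snd z \<bullet> snd z)"
    by (rule smooth_on_bilinear[OF T bounded_bilinear_inner snd snd])
  have \<alpha>: "smooth_on ?T (\<lambda>z. a + fst z * \<beta> (snd z \<bullet> snd z))"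
    by (rule smooth_on_add[OF T smooth_on_const[OF T] smooth_on_bilinear[OF T bounded_bilinear_mult fst
          smooth_on_compose_real[OF T \<beta> sq]]]) simp
  have w: "smooth_on ?T (\<lambda>z. ((snd z \<bullet> snd z) powr (- (1/2))) *\<^sub>R snd z)"
    by (rule smooth_on_bilinear[OF T bounded_bilinear_scaleR smooth_on_compose_real[OF T smooth_on_powr sq] snd]) auto
  have "smooth_on ?T (\<lambda>z. (sin (a + fst z * \<beta> (snd z \<bullet> snd z)) *\<^sub>R (((snd z \<bullet> snd z) powr (- (1/2))) *\<^sub>R snd z),
      cos (a + fst z * \<beta> (snd z \<bullet> snd z))))"
    by (rule smooth_on_Pair[OF T smooth_on_bilinear[OF T bounded_bilinear_scaleR
            smooth_on_compose_real[OF T smooth_on_sin \<alpha>] w] smooth_on_compose_real[OF T smooth_on_cos \<alpha>]]) auto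
  then show ?thesis
  proof (rule smooth_on_cong[OF T])
    fix z assume "z \<in> ?T"
    then have "snd z \<noteq> 0" by auto
    then have "(snd z \<bullet> snd z) powr (- (1/2)) = inverse (norm (snd z))"
      by (simp add: powr_minus powr_half_sqrt norm_eq_sqrt_inner)
    then show "(case z of (t, x) \<Rightarrow> sphere_point (x /\<^sub>R norm x) (a + t * \<beta> (x \<bullet> x)))
      = (sin (a + fst z * \<beta> (snd z \<bullet> snd z)) *\<^sub>R (((snd z \<bullet> snd z) powr (- (1/2))) *\<^sub>R snd z),
        cos (a + fst z * \<beta> (snd z \<bullet> snd z)))"
      by (simp add: sphere_point_def split_beta)
  qed
qed

lemma sphere_point_in_sphere:
  assumes "norm w = 1"
  shows "sphere_point w \<alpha> \<in> sphere 0 1"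
  using assms by (simp add: sphere_point_def norm_Pair power_mult_distrib)

lemma bienergy_radial:
  fixes f f1 :: "real \<Rightarrow> real"
  assumes f: "\<And>r. 0 < r \<Longrightarrow> r < 1 \<Longrightarrow> (f has_real_derivative f1 r) (at r)" "\<And>r. 0 < r \<Longrightarrow> r < 1 \<Longrightarrow> f r > 0"
    and f1: "continuous_on {0<..<1} f1"
    and uv: "0 < u" "u \<le> v" "v < 1"
    and \<alpha>: "\<And>s. (\<alpha> has_real_derivative \<alpha>1 s) (at s)" "\<And>s. (\<alpha>1 has_real_derivative \<alpha>2 s) (at s)"
      "continuous_on UNIV \<alpha>2"
  defines "m \<equiv> CARD('n::finite) - 1"
  shows "bienergy (warped_metric f) {x::real^'n. u \<le> norm x \<and> norm x \<le> v}
      (\<lambda>x. sphere_point (x /\<^sub>R norm x) (\<alpha> (x \<bullet> x)))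
    = 1/2 * (real CARD('n) * unit_ball_vol CARD('n)) * integral {u..v}
      (\<lambda>r. (4 * r\<^sup>2 * \<alpha>2 (r\<^sup>2) + 2 * \<alpha>1 (r\<^sup>2) + 2 * real m * r * f1 r / f r * \<alpha>1 (r\<^sup>2)
        - real m * sin (\<alpha> (r\<^sup>2)) * cos (\<alpha> (r\<^sup>2)) / (f r)\<^sup>2)\<^sup>2 * f r ^ m)"
proof -
  let ?K = "{x::real^'n. u \<le> norm x \<and> norm x \<le> v}"
  let ?\<Phi> = "\<lambda>x::real^'n. sphere_point (x /\<^sub>R norm x) (\<alpha> (x \<bullet> x))"
  define T where "T r = 4 * r\<^sup>2 * \<alpha>2 (r\<^sup>2) + 2 * \<alpha>1 (r\<^sup>2) + 2 * real m * r * f1 r / f r * \<alpha>1 (r\<^sup>2)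
        - real m * sin (\<alpha> (r\<^sup>2)) * cos (\<alpha> (r\<^sup>2)) / (f r)\<^sup>2" for r
  have m: "real m = real CARD('n) - 1"
    unfolding m_def by (subst of_nat_diff) (auto simp: Suc_le_eq)
  have cont: "continuous_on {u..v} f" "continuous_on {u..v} f1"
  proof -
    have "isCont f r" if "r \<in> {u..v}" for r
      by (rule DERIV_isCont[OF f(1)]) (use that uv in auto)
    then show "continuous_on {u..v} f"
      by (simp add: continuous_at_imp_continuous_on)
    show "continuous_on {u..v} f1"
      by (rule continuous_on_subset[OF f1]) (use uv in auto)
  qed
  have "continuous_on UNIV \<alpha>" "continuous_on UNIV \<alpha>1"
    using \<alpha>(1,2) by (meson DERIV_isCont continuous_at_imp_continuous_on)+
  note cont_\<alpha> = this[THEN continuous_on_compose2] \<alpha>(3)[THEN continuous_on_compose2]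
  have cont_\<alpha>: "continuous_on {u..v} (\<lambda>r. \<alpha> (r\<^sup>2))" "continuous_on {u..v} (\<lambda>r. \<alpha>1 (r\<^sup>2))"
    "continuous_on {u..v} (\<lambda>r. \<alpha>2 (r\<^sup>2))"
    by (rule cont_\<alpha>, intro continuous_intros, simp)+
  have f0: "f r > 0" if "r \<in> {u..v}" for r
    using that uv by (intro f(2)) auto
  have T: "continuous_on {u..v} T"
    unfolding T_def by (intro continuous_intros cont cont_\<alpha>) (use f0 in fastforce)+
  have G: "continuous_on {u..v} (\<lambda>r. (T r)\<^sup>2 * (f r / r) ^ m)"
    using uv by (intro continuous_intros cont T) auto
  have "bienergy (warped_metric f) ?K ?\<Phi> = 1/2 * (LINT x:?K|lborel. (T (norm x))\<^sup>2 * (f (norm x) / norm x) ^ m)"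
  proof -
    have "(norm (tension (warped_metric f) ?\<Phi> x))\<^sup>2 * vol_density (warped_metric f) x
        = (T (norm x))\<^sup>2 * (f (norm x) / norm x) ^ m" if "x \<in> ?K" for x
    proof -
      have r: "0 < norm x" "norm x < 1" using that uv by auto
      have "(norm (tension (warped_metric f) ?\<Phi> x))\<^sup>2 = (T (norm x))\<^sup>2"
        unfolding T_def m
        by (rule norm_tension_sphere_point[where S = "{0<..}"]) (use r f \<alpha> in auto)
      moreover have "vol_density (warped_metric f) x = (f (norm x) / norm x) ^ m"
        unfolding m_def by (rule vol_density_warped_metric) (use r f(2)[OF r] in auto)
      ultimately show ?thesis by simp
    qed
    moreover have "?K \<in> sets lborel" by simp
    ultimately show ?thesis
      unfolding bienergy_def by (subst set_lebesgue_integral_cong) auto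
  qed
  also have "(LINT x:?K|lborel. (T (norm x))\<^sup>2 * (f (norm x) / norm x) ^ m)
      = real CARD('n) * unit_ball_vol CARD('n) * integral {u..v} (\<lambda>r. (T r)\<^sup>2 * (f r / r) ^ m * r ^ m)"
    using radial_integral[OF _ _ G, where 'a = "real^'n"] uv by (simp add: m_def)
  also have "integral {u..v} (\<lambda>r. (T r)\<^sup>2 * (f r / r) ^ m * r ^ m) = integral {u..v} (\<lambda>r. (T r)\<^sup>2 * f r ^ m)"
    by (rule integral_cong) (use uv in \<open>auto simp: power_divide\<close>)
  finally show ?thesis by (simp add: T_def)
qed

section \<open>The Euler-Lagrange equation and its solutions\<close>

text \<open>
  Critical points are tested with the variation of the angle by \<open>t \<beta>(x \<bullet> x)\<close>.  Its bienergy is the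
  integral over a fixed interval of a function smooth in \<open>t\<close>, so it may be differentiated under the
  integral.
\<close>

lemma radial_first_variation:
  fixes f f1 :: "real \<Rightarrow> real"
  assumes n: "CARD('n::finite) = k + 5"
    and f: "\<And>r. 0 < r \<Longrightarrow> r < 1 \<Longrightarrow> (f has_real_derivative f1 r) (at r)" "\<And>r. 0 < r \<Longrightarrow> r < 1 \<Longrightarrow> f r > 0"
    and f1: "continuous_on {0<..<1} f1"
    and a: "0 < a" "a < pi / 2"
    and bih: "biharmonic_on (warped_metric f) (ball 0 1 - {0}) (phi_map a :: real^'n \<Rightarrow> (real^'n) \<times> real)"
    and uv: "0 < u" "u < v" "v < 1"
    and bump: "is_bump (u\<^sup>2) (v\<^sup>2) \<beta> \<beta>' \<beta>''"
  shows "integral {u..v} (\<lambda>r. f r ^ (k + 2) *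
      (4 * r\<^sup>2 * \<beta>'' (r\<^sup>2) + 2 * \<beta>' (r\<^sup>2) + 2 * (real k + 4) * r * f1 r / f r * \<beta>' (r\<^sup>2))
      - (real k + 4) * cos (2 * a) * f r ^ k * \<beta> (r\<^sup>2)) = 0"
proof -
  define m where "m = real k + 4"
  have smooth: "smooth_on UNIV \<beta>" and \<beta>: "\<And>s. (\<beta> has_real_derivative \<beta>' s) (at s)"
    and \<beta>1: "\<And>s. (\<beta>' has_real_derivative \<beta>'' s) (at s)"
    and \<beta>2: "continuous_on UNIV \<beta>''" and \<beta>0: "\<And>s. s \<notin> {u\<^sup>2<..<v\<^sup>2} \<Longrightarrow> \<beta> s = 0"
    using bump by (auto simp: is_bump_def)
  define K where "K = {x::real^'n. u \<le> norm x \<and> norm x \<le> v}"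
  define \<Phi> where "\<Phi> t x = sphere_point (x /\<^sub>R norm x) (a + t * \<beta> (x \<bullet> x))" for t and x :: "real^'n"
  have "K = cball 0 v - ball 0 u" by (auto simp: K_def)
  then have "compact K" by (simp add: compact_diff)
  have KU: "K \<subseteq> ball 0 1 - {0}" using uv by (auto simp: K_def)
  have outside: "\<Phi> t x = phi_map a x" if "x \<notin> K" for t x
  proof -
    have "x \<bullet> x \<notin> {u\<^sup>2<..<v\<^sup>2}"
      using that uv by (auto simp: K_def dot_square_norm intro: power2_less_imp_less dest!: power2_less_imp_less)
    then show ?thesis by (simp add: \<Phi>_def phi_map_def \<beta>0)
  qed
  have crit: "((\<lambda>t. bienergy (warped_metric f) K (\<Phi> t)) has_real_derivative 0) (at 0)"
  proof -
    have 1: "smooth_on ({-1<..<1} \<times> (ball 0 1 - {0})) (\<lambda>(t, x). \<Phi> t x)"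
      unfolding \<Phi>_def by (rule smooth_on_radial_variation[OF smooth])
    have 2: "\<forall>t\<in>{-1<..<1}. \<forall>x\<in>ball 0 1 - {0}. \<Phi> t x \<in> sphere 0 1"
      unfolding \<Phi>_def by (intro ballI sphere_point_in_sphere) simp
    have 3: "\<forall>x\<in>ball 0 1 - {0}. \<Phi> 0 x = phi_map a x"
      by (simp add: \<Phi>_def phi_map_def)
    have 4: "\<forall>t\<in>{-1<..<1}. \<forall>x\<in>ball 0 1 - {0} - K. \<Phi> t x = phi_map a x"
      using outside by blast
    show ?thesis
      using bih[unfolded biharmonic_on_def, THEN conjunct2, THEN conjunct2, rule_format, of 1 K \<Phi>]
        \<open>compact K\<close> KU 1 2 3 4 by simp
  qed
  define P where "P r = 4 * r\<^sup>2 * \<beta>'' (r\<^sup>2) + 2 * \<beta>' (r\<^sup>2) + 2 * m * r * f1 r / f r * \<beta>' (r\<^sup>2)" for r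
  define Q where "Q r = m / (f r)\<^sup>2" for r
  \<comment> \<open>\<open>T t r\<close> is the tension of the varied map, \<open>T'\<close> its derivative in \<open>t\<close>.\<close>
  define T where "T t r = t * P r - Q r * (sin (a + t * \<beta> (r\<^sup>2)) * cos (a + t * \<beta> (r\<^sup>2)))" for t r
  define T' where "T' t r = P r - Q r * (((cos (a + t * \<beta> (r\<^sup>2)))\<^sup>2 - (sin (a + t * \<beta> (r\<^sup>2)))\<^sup>2) * \<beta> (r\<^sup>2))" for t r
  define F where "F t r = (T t r)\<^sup>2 * f r ^ (k + 4)" for t r
  define F' where "F' t r = 2 * T t r * T' t r * f r ^ (k + 4)" for t r
  define c where "c = 1/2 * (real CARD('n) * unit_ball_vol CARD('n))"
  have "c > 0" by (simp add: c_def)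
  have E: "bienergy (warped_metric f) K (\<Phi> t) = c * integral {u..v} (F t)" for t
  proof -
    have "bienergy (warped_metric f) K (\<Phi> t) = c * integral {u..v}
      (\<lambda>r. (4 * r\<^sup>2 * (t * \<beta>'' (r\<^sup>2)) + 2 * (t * \<beta>' (r\<^sup>2)) + 2 * real (CARD('n) - 1) * r * f1 r / f r * (t * \<beta>' (r\<^sup>2))
        - real (CARD('n) - 1) * sin (a + t * \<beta> (r\<^sup>2)) * cos (a + t * \<beta> (r\<^sup>2)) / (f r)\<^sup>2)\<^sup>2 * f r ^ (CARD('n) - 1))"
      unfolding K_def \<Phi>_def[abs_def] c_def
      by (rule bienergy_radial[OF f f1])
        (use uv \<beta>2 in \<open>auto intro!: derivative_eq_intros \<beta> \<beta>1 continuous_intros\<close>)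
    also have "CARD('n) - 1 = k + 4" by (simp add: n)
    also have "(\<lambda>r. (4 * r\<^sup>2 * (t * \<beta>'' (r\<^sup>2)) + 2 * (t * \<beta>' (r\<^sup>2)) + 2 * real (k + 4) * r * f1 r / f r * (t * \<beta>' (r\<^sup>2))
        - real (k + 4) * sin (a + t * \<beta> (r\<^sup>2)) * cos (a + t * \<beta> (r\<^sup>2)) / (f r)\<^sup>2)\<^sup>2 * f r ^ (k + 4)) = F t"
      by (simp add: F_def T_def P_def Q_def m_def fun_eq_iff algebra_simps)
    finally show ?thesis .
  qed
  have f0: "f r > 0" if "r \<in> {u..v}" for r
    using that uv by (intro f(2)) auto
  have contf: "continuous_on {u..v} f"
  proof -
    have "isCont f r" if "r \<in> {u..v}" for r
      by (rule DERIV_isCont[OF f(1)]) (use that uv in auto)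
    then show ?thesis by (simp add: continuous_at_imp_continuous_on)
  qed
  have contf1: "continuous_on {u..v} f1"
    by (rule continuous_on_subset[OF f1]) (use uv in auto)
  have "continuous_on UNIV \<beta>" "continuous_on UNIV \<beta>'"
    using \<beta> \<beta>1 by (meson DERIV_isCont continuous_at_imp_continuous_on)+
  note sq = this[THEN continuous_on_compose2] \<beta>2[THEN continuous_on_compose2]
  have cont\<beta>: "continuous_on {u..v} (\<lambda>r. \<beta> (r\<^sup>2))" "continuous_on {u..v} (\<lambda>r. \<beta>' (r\<^sup>2))"
    "continuous_on {u..v} (\<lambda>r. \<beta>'' (r\<^sup>2))"
    by (rule sq, intro continuous_intros, simp)+
  have "continuous_on {u..v} P"
    unfolding P_def by (intro continuous_intros contf contf1 cont\<beta>) (use f0 in fastforce)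
  moreover have "continuous_on {u..v} Q"
    unfolding Q_def by (intro continuous_intros contf) (use f0 in fastforce)
  ultimately have cont: "continuous_on {u..v} f" "continuous_on {u..v} (\<lambda>r. \<beta> (r\<^sup>2))"
    "continuous_on {u..v} P" "continuous_on {u..v} Q"
    using contf cont\<beta>(1) by blast+
  have "continuous_on (UNIV \<times> {u..v}) (\<lambda>z. f (snd z))" "continuous_on (UNIV \<times> {u..v}) (\<lambda>z. \<beta> ((snd z)\<^sup>2))"
    "continuous_on (UNIV \<times> {u..v}) (\<lambda>z. P (snd z))" "continuous_on (UNIV \<times> {u..v}) (\<lambda>z. Q (snd z))"
    by (rule cont[THEN continuous_on_compose2], intro continuous_intros, auto)+
  then have contF': "continuous_on (UNIV \<times> {u..v}) (\<lambda>(t, r). F' t r)"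
    unfolding F'_def T_def T'_def split_beta
    by (intro continuous_intros)
  have contF: "continuous_on {u..v} (F t)" for t
    unfolding F_def T_def by (intro continuous_intros cont)
  have dF: "((\<lambda>t. F t r) has_real_derivative F' t r) (at t)" for t r
    unfolding F_def F'_def T_def T'_def
    by (auto intro!: derivative_eq_intros simp: power2_eq_square algebra_simps)
  have "((\<lambda>t. integral (cbox u v) (F t)) has_real_derivative integral (cbox u v) (F' 0)) (at 0 within UNIV)"
    by (rule leibniz_rule_field_derivative) (use dF contF contF' in \<open>auto intro: integrable_continuous_real\<close>)
  then have "((\<lambda>t. c * integral {u..v} (F t)) has_real_derivative c * integral {u..v} (F' 0)) (at 0)"
    by (intro DERIV_cmult) simp
  with crit have "c * integral {u..v} (F' 0) = 0"
    unfolding E by (rule DERIV_unique[symmetric])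
  then have I0: "integral {u..v} (F' 0) = 0" using \<open>c > 0\<close> by simp
  \<comment> \<open>At \<open>t = 0\<close> the tension is a constant divided by \<open>f\<^sup>2\<close>; that constant, nonzero for the given \<open>a\<close>, splits off.\<close>
  define J where "J r = f r ^ (k + 2) * P r - m * cos (2 * a) * f r ^ k * \<beta> (r\<^sup>2)" for r
  have "F' 0 r = (- 2 * m * sin a * cos a) * J r" if "r \<in> {u..v}" for r
  proof -
    have "f r \<noteq> 0" using f0[OF that] by simp
    then have 1: "f r ^ (k + 4) / (f r)\<^sup>2 = f r ^ (k + 2)" "f r ^ (k + 2) / (f r)\<^sup>2 = f r ^ k"
      by (simp_all add: power_add eval_nat_numeral)
    have "F' 0 r = - 2 * m * sin a * cos a * (f r ^ (k + 4) / (f r)\<^sup>2) * (P r - m * cos (2 * a) * \<beta> (r\<^sup>2) / (f r)\<^sup>2)"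
      by (simp add: F'_def T_def T'_def Q_def cos_double)
    also have "\<dots> = - 2 * m * sin a * cos a * (f r ^ (k + 2) * P r - m * cos (2 * a) * \<beta> (r\<^sup>2) * (f r ^ (k + 2) / (f r)\<^sup>2))"
      unfolding 1(1) by (simp add: algebra_simps)
    finally show ?thesis unfolding 1(2) J_def by (simp add: algebra_simps)
  qed
  then have "integral {u..v} (F' 0) = integral {u..v} (\<lambda>r. (- 2 * m * sin a * cos a) * J r)"
    by (rule integral_cong)
  also have "\<dots> = (- 2 * m * sin a * cos a) * integral {u..v} J"
    by (rule integral_mult_right)
  finally have "(- 2 * m * sin a * cos a) * integral {u..v} J = 0" using I0 by simp
  moreover have "sin a > 0" "cos a > 0"
    using a by (auto intro: sin_gt_zero cos_gt_zero)
  moreover have "m > 0" by (simp add: m_def)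
  ultimately have "integral {u..v} J = 0" by simp
  then show ?thesis by (simp add: J_def[abs_def] P_def m_def)
qed

text \<open>
  If \<open>W\<close> were nonzero at \<open>r\<close>, it would keep its sign on a small interval around \<open>r\<close>, and the integral
  against a bump supported there would not vanish.
\<close>

lemma fundamental_lemma_radial_bump:
  assumes W: "continuous_on {0<..<1} W"
    and int: "\<And>u v \<beta> \<beta>' \<beta>''. \<lbrakk>0 < u; u < v; v < 1; is_bump (u\<^sup>2) (v\<^sup>2) \<beta> \<beta>' \<beta>''\<rbrakk>
      \<Longrightarrow> integral {u..v} (\<lambda>r. W r * \<beta> (r\<^sup>2)) = 0"
    and r: "0 < r" "r < 1"
  shows "W r = (0::real)"
proof (rule ccontr)
  assume "W r \<noteq> 0"
  define V where "V y = W r * W y" for y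
  have V: "continuous_on {0<..<1} V" unfolding V_def by (intro continuous_intros W)
  have Vr: "V r > 0" using \<open>W r \<noteq> 0\<close> by (simp add: V_def flip: power2_eq_square)
  have "isCont V r"
    using V r by (simp add: continuous_on_eq_continuous_at)
  then have "\<forall>\<^sub>F y in at r. V y > 0"
    unfolding isCont_def by (rule order_tendstoD(1)[OF _ Vr])
  then obtain e where e0: "e > 0" "\<And>y. y \<noteq> r \<Longrightarrow> dist y r < e \<Longrightarrow> V y > 0"
    unfolding eventually_at by blast
  then have e: "V y > 0" if "dist y r < e" for y
    using that Vr by (cases "y = r") auto
  define \<delta> where "\<delta> = min (e / 2) (min (r / 2) ((1 - r) / 2))"
  have \<delta>: "\<delta> > 0" "\<delta> < e" "\<delta> < r" "\<delta> < 1 - r"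
    using e0(1) r by (auto simp: \<delta>_def min_def)
  define u v where "u = r - \<delta>" and "v = r + \<delta>"
  have uv: "0 < u" "u < r" "r < v" "v < 1"
    using \<delta> by (auto simp: u_def v_def)
  have pos: "V y > 0" if "y \<in> {u..v}" for y
    using that \<delta> by (intro e) (auto simp: u_def v_def dist_real_def)
  have "u\<^sup>2 < v\<^sup>2" using uv by (intro power_strict_mono) auto
  then obtain \<beta> \<beta>' \<beta>'' where b: "is_bump (u\<^sup>2) (v\<^sup>2) \<beta> \<beta>' \<beta>''"
    using smooth_bump_exists by blast
  then have \<beta>: "\<And>s. (\<beta> has_real_derivative \<beta>' s) (at s)" "\<And>s. s \<in> {u\<^sup>2<..<v\<^sup>2} \<Longrightarrow> \<beta> s > 0"
    "\<And>s. s \<notin> {u\<^sup>2<..<v\<^sup>2} \<Longrightarrow> \<beta> s = 0"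
    by (auto simp: is_bump_def)
  have cont_\<beta>: "continuous_on S \<beta>" for S
    using \<beta>(1) by (meson DERIV_isCont continuous_at_imp_continuous_on)
  have cont: "continuous_on {u..v} (\<lambda>y. V y * \<beta> (y\<^sup>2))"
    using uv by (intro continuous_intros continuous_on_subset[OF V] continuous_on_compose2[OF cont_\<beta>[of UNIV]]) auto
  have "((\<lambda>y. V y * \<beta> (y\<^sup>2)) has_integral 0) (cbox u v)"
  proof -
    have "integral {u..v} (\<lambda>y. W r * (W y * \<beta> (y\<^sup>2))) = 0"
      using int[OF uv(1) _ uv(4) b] uv by simp
    moreover have "(\<lambda>y. V y * \<beta> (y\<^sup>2)) integrable_on {u..v}"
      by (rule integrable_continuous_real[OF cont])
    ultimately show ?thesis
      by (simp add: V_def mult.assoc has_integral_iff)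
  qed
  then have "V r * \<beta> (r\<^sup>2) = 0"
  proof (rule has_integral_0_cbox_imp_0[rotated 2])
    show "continuous_on (cbox u v) (\<lambda>y. V y * \<beta> (y\<^sup>2))" using cont by simp
    show "0 \<le> V y * \<beta> (y\<^sup>2)" if "y \<in> box u v" for y
    proof -
      have "\<beta> (y\<^sup>2) \<ge> 0" using \<beta>(2,3)[of "y\<^sup>2"] by fastforce
      then show ?thesis using pos[of y] that by simp
    qed
  qed (use uv in auto)
  moreover have "r\<^sup>2 \<in> {u\<^sup>2<..<v\<^sup>2}"
    using uv by (auto intro!: power_strict_mono)
  ultimately show False using Vr \<beta>(2) by fastforce
qed

text \<open>
  With \<open>\<eta>(r) = \<beta>(r\<^sup>2)\<close> the integrand is the derivative of
  \<open>f\<^sup>k\<^sup>+\<^sup>2 \<eta>' + 2 f\<^sup>k\<^sup>+\<^sup>1 f' \<eta>\<close>, which vanishes at both ends of the support of the bump.  Here \<open>k = n - 5\<close>.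
\<close>

lemma radial_integration_by_parts:
  fixes f f1 f2 :: "real \<Rightarrow> real"
  assumes f: "\<And>r. 0 < r \<Longrightarrow> r < 1 \<Longrightarrow> (f has_real_derivative f1 r) (at r)" "\<And>r. 0 < r \<Longrightarrow> r < 1 \<Longrightarrow> f r > 0"
    and f1: "\<And>r. 0 < r \<Longrightarrow> r < 1 \<Longrightarrow> (f1 has_real_derivative f2 r) (at r)"
    and uv: "0 < u" "u < v" "v < 1"
    and bump: "is_bump (u\<^sup>2) (v\<^sup>2) \<beta> \<beta>' \<beta>''"
  shows "((\<lambda>r. (f r ^ (k + 2) *
      (4 * r\<^sup>2 * \<beta>'' (r\<^sup>2) + 2 * \<beta>' (r\<^sup>2) + 2 * (real k + 4) * r * f1 r / f r * \<beta>' (r\<^sup>2)) - C * f r ^ k * \<beta> (r\<^sup>2))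
      + f r ^ k * (2 * (real k + 1) * (f1 r)\<^sup>2 + 2 * f r * f2 r + C) * \<beta> (r\<^sup>2)) has_integral 0) {u..v}"
proof -
  have \<beta>: "\<And>s. (\<beta> has_real_derivative \<beta>' s) (at s)" "\<And>s. (\<beta>' has_real_derivative \<beta>'' s) (at s)"
    and "\<beta>' (u\<^sup>2) = 0" "\<beta>' (v\<^sup>2) = 0" "\<beta> (u\<^sup>2) = 0" "\<beta> (v\<^sup>2) = 0"
    using bump by (auto simp: is_bump_def)
  define B where "B r = f r ^ (k + 2) * (2 * r * \<beta>' (r\<^sup>2)) + 2 * f r ^ (k + 1) * f1 r * \<beta> (r\<^sup>2)" for r
  have B0: "B u = 0" "B v = 0"
    by (simp_all add: B_def \<open>\<beta>' (u\<^sup>2) = 0\<close> \<open>\<beta>' (v\<^sup>2) = 0\<close> \<open>\<beta> (u\<^sup>2) = 0\<close> \<open>\<beta> (v\<^sup>2) = 0\<close>)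
  let ?b = "\<lambda>r. (f r ^ (k + 2) *
      (4 * r\<^sup>2 * \<beta>'' (r\<^sup>2) + 2 * \<beta>' (r\<^sup>2) + 2 * (real k + 4) * r * f1 r / f r * \<beta>' (r\<^sup>2)) - C * f r ^ k * \<beta> (r\<^sup>2))
      + f r ^ k * (2 * (real k + 1) * (f1 r)\<^sup>2 + 2 * f r * f2 r + C) * \<beta> (r\<^sup>2)"
  have dB: "(B has_real_derivative ?b r) (at r)" if "r \<in> {u..v}" for r
  proof -
    have r: "0 < r" "r < 1" using that uv by auto
    have sq: "((\<lambda>r. r\<^sup>2) has_real_derivative 2 * r) (at r)"
      by (auto intro!: derivative_eq_intros)
    have b: "((\<lambda>r. \<beta> (r\<^sup>2)) has_real_derivative \<beta>' (r\<^sup>2) * (2 * r)) (at r)"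
      "((\<lambda>r. \<beta>' (r\<^sup>2)) has_real_derivative \<beta>'' (r\<^sup>2) * (2 * r)) (at r)"
      by (rule DERIV_chain2[OF \<beta>(1) sq], rule DERIV_chain2[OF \<beta>(2) sq])
    have p: "((\<lambda>r. f r ^ (k + 2)) has_real_derivative (real k + 2) * f r ^ (k + 1) * f1 r) (at r)"
      "((\<lambda>r. f r ^ (k + 1)) has_real_derivative (real k + 1) * f r ^ k * f1 r) (at r)"
      using DERIV_power[OF f(1)[OF r], of "k + 2"] DERIV_power[OF f(1)[OF r], of "k + 1"]
      by (simp_all add: algebra_simps)
    have lin: "((\<lambda>r. 2 * r) has_real_derivative 2) (at r)"
      by (auto intro!: derivative_eq_intros)
    have "(B has_real_derivative
        ((real k + 2) * f r ^ (k + 1) * f1 r) * (2 * r * \<beta>' (r\<^sup>2))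
        + (2 * \<beta>' (r\<^sup>2) + \<beta>'' (r\<^sup>2) * (2 * r) * (2 * r)) * f r ^ (k + 2)
        + ((2 * ((real k + 1) * f r ^ k * f1 r) * f1 r + f2 r * (2 * f r ^ (k + 1))) * \<beta> (r\<^sup>2)
        + \<beta>' (r\<^sup>2) * (2 * r) * (2 * f r ^ (k + 1) * f1 r))) (at r)"
      unfolding B_def
      by (intro DERIV_add DERIV_mult p b lin f1[OF r] DERIV_cmult)
    moreover have "((real k + 2) * f r ^ (k + 1) * f1 r) * (2 * r * \<beta>' (r\<^sup>2))
        + (2 * \<beta>' (r\<^sup>2) + \<beta>'' (r\<^sup>2) * (2 * r) * (2 * r)) * f r ^ (k + 2)
        + ((2 * ((real k + 1) * f r ^ k * f1 r) * f1 r + f2 r * (2 * f r ^ (k + 1))) * \<beta> (r\<^sup>2)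
        + \<beta>' (r\<^sup>2) * (2 * r) * (2 * f r ^ (k + 1) * f1 r)) = ?b r"
    proof -
      have "f r ^ (k + 2) * (x / f r * y) = f r ^ (k + 1) * x * y" for x y
        using f(2)[OF r] by (simp add: power_add power2_eq_square)
      then show ?thesis
        by (simp add: distrib_left right_diff_distrib) (simp add: algebra_simps power2_eq_square)
    qed
    ultimately show ?thesis by simp
  qed
  have "(?b has_integral (B v - B u)) {u..v}"
    by (rule fundamental_theorem_of_calculus)
      (use uv dB in \<open>auto simp: has_real_derivative_iff_has_vector_derivative[symmetric] intro: has_field_derivative_at_within\<close>)
  then show ?thesis by (simp add: B0)
qed

text \<open>
  Letting \<open>r\<close> tend to the pole in the equation determines \<open>C\<close>.  Then \<open>f\<^sup>2\<^sup>(\<^sup>k\<^sup>+\<^sup>1\<^sup>) (f'\<^sup>2 - 1)\<close> is a first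
  integral that vanishes at the pole, and this leaves only \<open>f'\<^sup>2 = 1\<close>.
\<close>

lemma warping_rigidity:
  fixes f f1 f2 :: "real \<Rightarrow> real"
  assumes f: "\<And>r. 0 < r \<Longrightarrow> r < 1 \<Longrightarrow> (f has_real_derivative f1 r) (at r)" "\<And>r. 0 < r \<Longrightarrow> r < 1 \<Longrightarrow> f r > 0"
    and f1: "\<And>r. 0 < r \<Longrightarrow> r < 1 \<Longrightarrow> (f1 has_real_derivative f2 r) (at r)"
    and cont: "continuous_on {0..1} f" "continuous_on {0..1} f1" "continuous_on {0..1} f2"
    and init: "f 0 = 0" "f1 0 = 1"
    and ode: "\<And>r. 0 < r \<Longrightarrow> r < 1 \<Longrightarrow> 2 * (real k + 1) * (f1 r)\<^sup>2 + 2 * f r * f2 r + C = 0"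
  shows "C = - 2 * (real k + 1)" and "\<forall>r\<in>{0..1}. f r = r"
proof -
  have "2 * (real k + 1) * (f1 0)\<^sup>2 + 2 * f 0 * f2 0 + C = 0"
  proof (rule continuous_constant_on_closure[where S = "{0<..<1}" and f = "\<lambda>r. 2 * (real k + 1) * (f1 r)\<^sup>2 + 2 * f r * f2 r + C"])
    show "continuous_on (closure {0<..<1}) (\<lambda>r. 2 * (real k + 1) * (f1 r)\<^sup>2 + 2 * f r * f2 r + C)"
      by (auto intro!: continuous_intros cont)
  qed (use ode in auto)
  then show C: "C = - 2 * (real k + 1)" by (simp add: init)
  have ode': "f r * f2 r = - (real k + 1) * ((f1 r)\<^sup>2 - 1)" if "0 < r" "r < 1" for r
    using ode[OF that] by (simp add: C algebra_simps)
  define N where "N = 2 * (k + 1)"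
  define w where "w r = f r ^ N * ((f1 r)\<^sup>2 - 1)" for r
  have "(w has_real_derivative 0) (at r)" if r: "0 < r" "r < 1" for r
  proof -
    have "(w has_real_derivative real N * f r ^ (N - 1) * f1 r * ((f1 r)\<^sup>2 - 1) + f r ^ N * (2 * f1 r * f2 r)) (at r)"
      unfolding w_def
      by (rule DERIV_cong[OF DERIV_mult[OF DERIV_power[OF f(1)[OF r]] DERIV_diff[OF DERIV_power[OF f1[OF r]] DERIV_const]]])
        (simp add: algebra_simps)
    moreover have "f r ^ N = f r ^ (N - 1) * f r"
      by (simp add: N_def)
    moreover have "real N * f r ^ (N - 1) * f1 r * ((f1 r)\<^sup>2 - 1) + f r ^ (N - 1) * f r * (2 * f1 r * f2 r)
      = f r ^ (N - 1) * f1 r * (real N * ((f1 r)\<^sup>2 - 1) + 2 * (f r * f2 r))"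
      by (simp add: algebra_simps)
    moreover have "real N * ((f1 r)\<^sup>2 - 1) + 2 * (f r * f2 r) = 0"
      unfolding ode'[OF r] by (simp add: N_def algebra_simps)
    ultimately show ?thesis by simp
  qed
  moreover have "continuous_on {0..1} w"
    unfolding w_def by (intro continuous_intros cont)
  ultimately have "w r = w 0" if "r \<in> {0..1}" for r
    using that by (intro DERIV_isconst2[of 0 1]) auto
  then have "w r = 0" if "r \<in> {0..1}" for r
    using that by (simp add: w_def init N_def)
  then have w0: "w r = 0" if "0 < r" "r < 1" for r
    using that by simp
  have "(f1 r)\<^sup>2 = 1" if "0 < r" "r < 1" for r
    using w0[OF that] f(2)[OF that] by (simp add: w_def)
  then have f2: "f2 r = 0" if "0 < r" "r < 1" for r
    using ode'[OF that] f(2)[OF that] that by simp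
  have "f1 r = f1 0" if "r \<in> {0..1}" for r
  proof (rule DERIV_isconst2[of 0 1 f1])
    show "(f1 has_real_derivative 0) (at x)" if "0 < x" "x < 1" for x
      using f1[OF that] f2[OF that] by simp
  qed (use that cont(2) in auto)
  then have f1_1: "f1 r = 1" if "r \<in> {0..1}" for r
    using that init by simp
  have "f r - r = f 0 - 0" if "r \<in> {0..1}" for r
  proof (rule DERIV_isconst2[of 0 1 "\<lambda>r. f r - r"])
    show "((\<lambda>r. f r - r) has_real_derivative 0) (at x)" if "0 < x" "x < 1" for x
      using DERIV_diff[OF f(1)[OF that] DERIV_ident] f1_1[of x] that by simp
  qed (use that in \<open>auto intro!: continuous_intros cont\<close>)
  then show "\<forall>r\<in>{0..1}. f r = r" using init by simp
qed

lemma warping_function_derivatives: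
  assumes "warping_function f"
  shows "\<And>r. 0 < r \<Longrightarrow> r < 1 \<Longrightarrow> (deriv01 f k has_real_derivative deriv01 f (Suc k) r) (at r)"
    and "continuous_on {0..1} (deriv01 f k)"
proof -
  have d: "deriv01 f k differentiable (at r within {0..1})" if "r \<in> {0..1}" for r
    using assms that by (auto simp: warping_function_def)
  then show "continuous_on {0..1} (deriv01 f k)"
    by (simp add: continuous_on_eq_continuous_within differentiable_imp_continuous_within)
  fix r :: real assume r: "0 < r" "r < 1"
  have "(deriv01 f k has_vector_derivative deriv01 f (Suc k) r) (at r within {0..1})"
    using d[of r] r by (simp add: vector_derivative_works)
  moreover have "at r within {0..1} = at r"
    using r by (intro at_within_interior) auto
  ultimately show "(deriv01 f k has_real_derivative deriv01 f (Suc k) r) (at r)"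
    by (simp only: has_real_derivative_iff_has_vector_derivative)
qed

text \<open>
  Since \<open>2 a < \<pi>\<close>, the cosine exceeds \<open>- 1\<close>, which bounds \<open>k\<close> by 1.
\<close>

lemma critical_angle:
  assumes a: "0 < a" "a < pi / 2"
    and eq: "(real k + 4) * cos (2 * a) = - 2 * (real k + 1)"
  shows "k = 0 \<and> a = pi / 3 \<or> k = 1 \<and> a = arccos (- 4 / 5) / 2"
proof -
  have "cos (2 * a) > cos pi" using a by (intro cos_monotone_0_pi) auto
  then have "(real k + 4) * cos (2 * a) > (real k + 4) * (-1)"
    by (intro mult_strict_left_mono) auto
  then have "real k < 2" unfolding eq by (simp add: distrib_left)
  then have "k = 0 \<or> k = 1" by linarith
  moreover have arc: "2 * a = arccos (cos (2 * a))" using a by (intro arccos_cos[symmetric]) auto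
  moreover have "a = pi / 3" if "k = 0"
  proof -
    have "4 * cos (2 * a) = - 2" using eq that by simp
    then have "cos (2 * a) = cos (2 * pi / 3)" unfolding cos_120 by linarith
    with arc have "2 * a = arccos (cos (2 * pi / 3))" by (simp only:)
    also have "\<dots> = 2 * pi / 3" by (rule arccos_cos) (use pi_gt_zero in linarith)+
    finally show ?thesis by linarith
  qed
  moreover have "a = arccos (- 4 / 5) / 2" if "k = 1"
  proof -
    have "5 * cos (2 * a) = - 4" using eq that by simp
    then have "cos (2 * a) = - 4 / 5" by linarith
    with arc have "2 * a = arccos (- 4 / 5)" by (simp only:)
    then show ?thesis by linarith
  qed
  ultimately show ?thesis by blast
qed


theorem theorem6p1:
  fixes f :: "real \<Rightarrow> real" and a :: real
  assumes "CARD('n::finite) \<ge> 5"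
    and "warping_function f"
    and "0 < a" and "a < pi / 2"
    and "weakly_biharmonic_ball f (phi_map a :: real^'n \<Rightarrow> (real^'n) \<times> real)"
  shows "(\<forall>\<rho>\<in>{0..1}. f \<rho> = \<rho>) \<and>
         ((CARD('n) = 5 \<and> a = pi / 3) \<or> (CARD('n) = 6 \<and> a = arccos (-4/5) / 2))"
proof -
  obtain k where n: "CARD('n) = k + 5"
    using assms(1) le_Suc_ex by (metis add.commute)
  define f1 f2 where "f1 = deriv01 f 1" and "f2 = deriv01 f 2"
  have f: "(f has_real_derivative f1 r) (at r)" and f1: "(f1 has_real_derivative f2 r) (at r)"
    and pos: "f r > 0" if "0 < r" "r < 1" for r
    using warping_function_derivatives(1)[OF assms(2) that, of 0]
      warping_function_derivatives(1)[OF assms(2) that, of 1] assms(2) that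
    by (auto simp: f1_def f2_def numeral_2_eq_2 warping_function_def)
  have cont: "continuous_on {0..1} f" "continuous_on {0..1} f1" "continuous_on {0..1} f2"
    using warping_function_derivatives(2)[OF assms(2), of 0] warping_function_derivatives(2)[OF assms(2), of 1]
      warping_function_derivatives(2)[OF assms(2), of 2]
    by (simp_all add: f1_def f2_def)
  have init: "f 0 = 0" "f1 0 = 1"
    using assms(2) by (auto simp: warping_function_def f1_def)
  define C where "C = (real k + 4) * cos (2 * a)"
  \<comment> \<open>Up to sign, \<open>W\<close> is the factor of the bump that integration by parts leaves.\<close>
  define W where "W r = f r ^ k * (2 * (real k + 1) * (f1 r)\<^sup>2 + 2 * f r * f2 r + C)" for r
  have contI: "continuous_on {0<..<1} f" "continuous_on {0<..<1} f1" "continuous_on {0<..<1} f2"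
    by (rule cont[THEN continuous_on_subset]; auto)+
  have contW: "continuous_on {0<..<1} W"
    unfolding W_def by (intro continuous_intros contI)
  have bih: "biharmonic_on (warped_metric f) (ball 0 1 - {0}) (phi_map a :: real^'n \<Rightarrow> (real^'n) \<times> real)"
    using assms(5) by (simp add: weakly_biharmonic_ball_def)
  have "W r = 0" if r: "0 < r" "r < 1" for r
  proof (rule fundamental_lemma_radial_bump[OF contW _ r])
    fix u v :: real and \<beta> \<beta>' \<beta>'' :: "real \<Rightarrow> real"
    assume uv: "0 < u" "u < v" "v < 1" and bump: "is_bump (u\<^sup>2) (v\<^sup>2) \<beta> \<beta>' \<beta>''"
    define J where "J r = f r ^ (k + 2) *
      (4 * r\<^sup>2 * \<beta>'' (r\<^sup>2) + 2 * \<beta>' (r\<^sup>2) + 2 * (real k + 4) * r * f1 r / f r * \<beta>' (r\<^sup>2)) - C * f r ^ k * \<beta> (r\<^sup>2)" for r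
    have J0: "integral {u..v} J = 0"
      unfolding J_def[abs_def] C_def
      by (rule radial_first_variation[OF n f pos contI(2) assms(3,4) bih uv bump])
    have sum: "((\<lambda>r. J r + W r * \<beta> (r\<^sup>2)) has_integral 0) {u..v}"
      unfolding J_def W_def by (rule radial_integration_by_parts[OF f pos f1 uv bump])
    have "continuous_on UNIV \<beta>"
      using bump unfolding is_bump_def by (meson DERIV_isCont continuous_at_imp_continuous_on)
    then have "continuous_on {u..v} (\<lambda>r. \<beta> (r\<^sup>2))"
      by (rule continuous_on_compose2) (auto intro!: continuous_intros)
    moreover have "continuous_on {u..v} W"
      by (rule continuous_on_subset[OF contW]) (use uv in auto)
    ultimately have "(\<lambda>r. W r * \<beta> (r\<^sup>2)) integrable_on {u..v}"
      by (intro integrable_continuous_real continuous_intros)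
    then have W: "((\<lambda>r. W r * \<beta> (r\<^sup>2)) has_integral integral {u..v} (\<lambda>r. W r * \<beta> (r\<^sup>2))) {u..v}"
      by (rule integrable_integral)
    have "(J has_integral 0 - integral {u..v} (\<lambda>r. W r * \<beta> (r\<^sup>2))) {u..v}"
      using has_integral_diff[OF sum W] by simp
    with J0 show "integral {u..v} (\<lambda>r. W r * \<beta> (r\<^sup>2)) = 0"
      by (simp add: integral_unique)
  qed
  then have ode: "2 * (real k + 1) * (f1 r)\<^sup>2 + 2 * f r * f2 r + C = 0" if "0 < r" "r < 1" for r
    using that pos[OF that] unfolding W_def by fastforce
  have "C = - 2 * (real k + 1)" and flat: "\<forall>r\<in>{0..1}. f r = r"
    by (rule warping_rigidity[OF f pos f1 cont init ode]; assumption)+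
  then have "k = 0 \<and> a = pi / 3 \<or> k = 1 \<and> a = arccos (- 4 / 5) / 2"
    unfolding C_def by (intro critical_angle assms(3,4))
  then show ?thesis
    using flat n by auto
qed

end
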